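(* Let $n\ge2$, $A_1,\dots,A_d\in\mathfrak{su}(n)$, and $\mathrm S_1\subseteq\{B_{ij}\}$, $\mathrm S_2\subseteq\{C_{ij}\}$, $\mathrm S_3\subseteq\{D_{ij}\}$ (all with $1\le i<j\le n$). Let $\mathscr G_{\rm drift}$ and $\mathscr G_{\rm contr}$ be the edge-colored multigraphs defined in the context, and suppose $\mathscr G_{\rm contr}$ is connected. Then the system $\dot X=\mathsf B_0X+(\sum_{i=1}^m u_i\mathsf B_i)X$ is structurally controllable on $\mathrm{SU}(n)$ with respect to the pair of zero patterns $\big(\Sigma_{\rm r}(\{A_1,\dots,A_d\}),\Sigma_{\rm f}(\mathrm S_1\cup\mathrm S_2\cup\mathrm S_3)\big)$ if and only if the union multigraph $\mathscr G_{\rm drift}\cup\mathscr G_{\rm contr}$ has a self-loop or a cycle containing an odd number of Red edges.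
   Context: $E_{ij}$ is the $n\times n$ matrix unit; $B_{ij}=E_{ij}-E_{ji}$, $C_{ij}=\mathrm i(E_{ij}+E_{ji})$, $D_{ij}=\mathrm i(E_{ii}-E_{jj})$, where $\mathrm i$ is the imaginary unit. $\mathfrak{su}(n)$ (traceless skew-Hermitian matrices, a real Lie algebra) is the Lie algebra of $\mathrm{SU}(n)$. For a finite subset $\{g_s\}$ of a real Lie algebra, $\Sigma_{\rm f}(\{g_s\})=\{\sum l_sg_s:l_s\in\mathbb R\}$, $\Sigma_{\rm r}(\{g_s\})=\{\sum l_sg_s:l_s\in\mathbb R,l_s\ne0\ \forall s\}$. An edge-colored multigraph on $\mathrm V=\{1,\dots,n\}$ has edges $\{i,j;c\}$ with color $c\in\{\text{Blue},\text{Red},\text{Green}\}$; $\{i,i;c\}$ is a self-loop; edges with the same endpoints but different colors are distinct. $\mathscr G_{\rm drift}$ has: a Blue edge $\{i,j\}$ ($i\ne j$) iff $\mathrm{Re}([A_s]_{ij})=-\mathrm{Re}([A_s]_{ji})\ne0$ for some $s$; a Red edge $\{i,j\}$ ($i\neq j$) iff $\mathrm{Im}([A_s]_{ij})=\mathrm{Im}([A_s]_{ji})\neq0$ for some $s$; a Green self-loop $\{i,i\}$ iff $[A_s]_{ii}\ne0$ for some $s$. $\mathscr G_{\rm contr}$ has a Blue edge $\{i,j\}$ for each $B_{ij}\in\mathrm S_1$, a Red edge $\{i,j\}$ for each $C_{ij}\in\mathrm S_2$, and Green self-loops $\{i,i\}$ and $\{j,j\}$ for each $D_{ij}\in\mathrm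 S_3$. The union has node set $\mathrm V$ and the union of edge sets. A walk is an alternating sequence of nodes and edges with consecutive endpoints; a cycle is a closed walk; a multigraph is connected if any two nodes are joined by a walk. (E.g. a Blue and a Red edge with the same endpoints form a cycle with an odd number of Red edges.) For $\dot X=\mathsf B_0X+(\sum_{i=1}^m u_i\mathsf B_i)X$ on $\mathrm{SU}(n)$ (piecewise continuous real controls), the system is controllable if every element of $\mathrm{SU}(n)$ is reachable from $X(0)=I$ at some time $T\ge0$; it is structurally controllable w.r.t. $(\Sigma_{\rm r}(\mathfrak g_\alpha),\Sigma_{\rm f}(\mathfrak g_\beta))$ if there exist $m\ge1$, $\mathsf B_0\in\Sigma_{\rm r}(\mathfrak g_\alpha)$, $\mathsf B_1,\dots,\mathsf B_m\in\Sigma_{\rm f}(\mathfrak g_\beta)$ making it controllable. *)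

theory Defs
  imports "HOL-Analysis.Analysis"
begin

text \<open>n x n complex matrices, indexed by a finite linearly ordered type 'n (so n = CARD('n)).\<close>
type_synonym 'n cmat = "complex^'n^'n"

definition ctrans :: "'n::finite cmat \<Rightarrow> 'n cmat" where
  "ctrans A = (\<chi> a b. cnj (A $ b $ a))"

definition mtrace :: "'n::finite cmat \<Rightarrow> complex" where
  "mtrace A = (\<Sum>i\<in>UNIV. A $ i $ i)"

definition su :: "'n::finite cmat set" where
  "su = {A. ctrans A = - A \<and> mtrace A = 0}"

definition SU :: "'n::finite cmat set" where
  "SU = {X. X ** ctrans X = mat 1 \<and> ctrans X ** X = mat 1 \<and> det X = 1}"

definition cscale :: "complex \<Rightarrow> 'n::finite cmat \<Rightarrow> 'n cmat" where
  "cscale c M = (\<chi> a b. c * M $ a $ b)"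

definition Emat :: "'n::finite \<Rightarrow> 'n \<Rightarrow> 'n cmat" where
  "Emat i j = (\<chi> a b. if a = i \<and> b = j then 1 else 0)"

definition Bmat :: "'n::finite \<Rightarrow> 'n \<Rightarrow> 'n cmat" where
  "Bmat i j = Emat i j - Emat j i"

definition Cmat :: "'n::finite \<Rightarrow> 'n \<Rightarrow> 'n cmat" where
  "Cmat i j = cscale \<i> (Emat i j + Emat j i)"

definition Dmat :: "'n::finite \<Rightarrow> 'n \<Rightarrow> 'n cmat" where
  "Dmat i j = cscale \<i> (Emat i i - Emat j j)"

definition Sigma_f :: "'n::finite cmat set \<Rightarrow> 'n cmat set" where
  "Sigma_f G = {(\<Sum>g\<in>G. l g *\<^sub>R g) | l. True}"

definition Sigma_r :: "'n::finite cmat set \<Rightarrow> 'n cmat set" where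
  "Sigma_r G = {(\<Sum>g\<in>G. l g *\<^sub>R g) | l. \<forall>g\<in>G. l g \<noteq> 0}"

text \<open>Piecewise continuity on [a,b]: finitely many breakpoints (including a and b), and on each
  open piece between consecutive breakpoints the function extends continuously to the closed piece
  (i.e. finite one-sided limits exist).\<close>
definition piecewise_continuous_on :: "real \<Rightarrow> real \<Rightarrow> (real \<Rightarrow> real) \<Rightarrow> bool" where
  "piecewise_continuous_on a b f \<longleftrightarrow>
     (\<exists>P. finite P \<and> a \<in> P \<and> b \<in> P \<and> P \<subseteq> {a..b} \<and>
        (\<forall>s\<in>P. \<forall>t\<in>P. s < t \<and> {s<..<t} \<inter> P = {} \<longrightarrow>
           (\<exists>g. continuous_on {s..t} g \<and> (\<forall>x\<in>{s<..<t}. g x = f x))))"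

definition reachable :: "'n::finite cmat \<Rightarrow> (nat \<Rightarrow> 'n cmat) \<Rightarrow> nat \<Rightarrow> 'n cmat \<Rightarrow> bool" where
  "reachable B0 B m Y \<longleftrightarrow>
     (\<exists>T::real. T \<ge> 0 \<and> (\<exists>(u::nat \<Rightarrow> real \<Rightarrow> real) (X::real \<Rightarrow> 'n cmat).
        (\<forall>i\<in>{1..m}. piecewise_continuous_on 0 T (u i)) \<and>
        continuous_on {0..T} X \<and> X 0 = mat 1 \<and> X T = Y \<and>
        (\<exists>D. finite D \<and> (\<forall>t\<in>{0<..<T} - D.
           (X has_vector_derivative ((B0 + (\<Sum>i\<in>{1..m}. u i t *\<^sub>R B i)) ** X t)) (at t)))))"

definition controllable :: "'n::finite cmat \<Rightarrow> (nat \<Rightarrow> 'n cmat) \<Rightarrow> nat \<Rightarrow> bool" where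
  "controllable B0 B m \<longleftrightarrow> (\<forall>Y\<in>SU. reachable B0 B m Y)"

definition structurally_controllable :: "'n::finite cmat set \<Rightarrow> 'n cmat set \<Rightarrow> bool" where
  "structurally_controllable Ga Gb \<longleftrightarrow>
     (\<exists>m::nat. m \<ge> 1 \<and> (\<exists>B0\<in>Sigma_r Ga. \<exists>B. (\<forall>i\<in>{1..m}. B i \<in> Sigma_f Gb) \<and> controllable B0 B m))"

text \<open>Edge-colored multigraphs on the node set UNIV :: 'n set. An edge is a pair
  (set of endpoints, colour); {i} encodes the self-loop {i,i}.\<close>
datatype color = Blue | Red | Green

type_synonym 'n cedge = "'n set \<times> color"

definition walk :: "'n cedge set \<Rightarrow> 'n list \<Rightarrow> 'n cedge list \<Rightarrow> bool" where
  "walk E vs es \<longleftrightarrow> length vs = Suc (length es) \<and>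
     (\<forall>k<length es. es ! k \<in> E \<and> fst (es ! k) = {vs ! k, vs ! Suc k})"

definition cycle :: "'n cedge set \<Rightarrow> 'n list \<Rightarrow> 'n cedge list \<Rightarrow> bool" where
  "cycle E vs es \<longleftrightarrow> walk E vs es \<and> hd vs = last vs"

definition red_count :: "'n cedge list \<Rightarrow> nat" where
  "red_count es = length (filter (\<lambda>e. snd e = Red) es)"

definition connected_mg :: "'n cedge set \<Rightarrow> bool" where
  "connected_mg E \<longleftrightarrow> (\<forall>i j. \<exists>vs es. walk E vs es \<and> hd vs = i \<and> last vs = j)"

definition has_self_loop :: "'n cedge set \<Rightarrow> bool" where
  "has_self_loop E \<longleftrightarrow> (\<exists>i c. ({i}, c) \<in> E)"

definition G_drift :: "'n::finite cmat set \<Rightarrow> 'n cedge set" where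
  "G_drift As =
     {({i, j}, Blue) | i j. i \<noteq> j \<and> (\<exists>A\<in>As. Re (A $ i $ j) = - Re (A $ j $ i) \<and> Re (A $ i $ j) \<noteq> 0)}
   \<union> {({i, j}, Red) | i j. i \<noteq> j \<and> (\<exists>A\<in>As. Im (A $ i $ j) = Im (A $ j $ i) \<and> Im (A $ i $ j) \<noteq> 0)}
   \<union> {({i}, Green) | i. \<exists>A\<in>As. A $ i $ i \<noteq> 0}"

text \<open>S1, S2, S3 are given by their index pairs (i,j), i < j: B_ij \<in> S1 iff (i,j) \<in> S1 etc.\<close>
definition G_contr :: "('n \<times> 'n) set \<Rightarrow> ('n \<times> 'n) set \<Rightarrow> ('n \<times> 'n) set \<Rightarrow> 'n cedge set" where
  "G_contr S1 S2 S3 =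
     {({i, j}, Blue) | i j. (i, j) \<in> S1}
   \<union> {({i, j}, Red) | i j. (i, j) \<in> S2}
   \<union> {({i}, Green) | i j. (i, j) \<in> S3}
   \<union> {({j}, Green) | i j. (i, j) \<in> S3}"

end

theory Submission
  imports Defs
begin

text \<open>
  Necessity. If there is no self-loop and no cycle with an odd number of Red edges, the parity of Red
  edges along walks two-colours the nodes. Complex conjugation, twisted by the signs of this
  colouring, is multiplicative and fixes the drift and all controls, hence fixes every reachable
  matrix; it does not fix \<open>diag(\<i>, -\<i>, 1, \<dots>, 1)\<close>.

  Sufficiency. Along walks the brackets of the \<open>B\<^sub>i\<^sub>j\<close> and \<open>C\<^sub>i\<^sub>j\<close> multiply parities, so connectedness puts
  \<open>B\<^sub>i\<^sub>j\<close> or \<open>C\<^sub>i\<^sub>j\<close> into the control Lie algebra for all \<open>i \<noteq> j\<close>, and an inconsistent edge or a self-loop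
  supplies the missing one for some pair, whence all of su(n) is generated. It remains to see
  that the semigroup \<open>R\<close> generated by \<open>exp(t W)\<close>, \<open>t \<ge> 0\<close>, is SU(n) whenever the matrices \<open>W\<close> generate su(n).
  The span of all \<open>r W r\<^sup>*\<close>, \<open>r \<in> R\<close>, is invariant under bracketing with each \<open>W\<close>, so it is su(n); therefore some
  product of exponentials has a surjective derivative in its times and \<open>R\<close> has an interior
  point \<open>p\<close>. A power of \<open>p\<close> returns near 1 by compactness, so \<open>R\<close> contains a neighbourhood of 1 and is a
  compact group containing every \<open>exp(t A)\<close>. Finally, the maximiser of a weighted trace
  on \<open>R U R\<close> is diagonal, and diagonal matrices lie in \<open>R\<close>.
\<close>

section \<open>Matrices, SU(n) and su(n)\<close>

lemma bounded_bilinear_matrix_mult: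
  "bounded_bilinear ((**) :: 'n::finite cmat \<Rightarrow> 'n cmat \<Rightarrow> 'n cmat)"
proof -
  have "bilinear ((**) :: 'n cmat \<Rightarrow> 'n cmat \<Rightarrow> 'n cmat)"
    unfolding bilinear_def
    by (auto intro!: linearI simp: vec_eq_iff matrix_matrix_mult_def distrib_left distrib_right
        sum.distrib scaleR_sum_right)
  then show ?thesis
    by (simp add: bilinear_conv_bounded_bilinear)
qed

text \<open>Provides the product rule, continuity and distributivity of matrix multiplication as
  \<open>mm\<close> facts.\<close>

interpretation mm: bounded_bilinear "(**) :: 'n::finite cmat \<Rightarrow> 'n cmat \<Rightarrow> 'n cmat"
  by (rule bounded_bilinear_matrix_mult)

lemma ctrans_nth [simp]: "ctrans A $ i $ j = cnj (A $ j $ i)"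
  by (simp add: ctrans_def)

lemma bounded_linear_ctrans: "bounded_linear (ctrans :: 'n::finite cmat \<Rightarrow> 'n cmat)"
  unfolding linear_conv_bounded_linear [symmetric]
  by (rule linearI) (simp_all add: vec_eq_iff)

lemma ctrans_zero [simp]: "ctrans 0 = 0"
  and ctrans_add: "ctrans (A + B) = ctrans A + ctrans B"
  and ctrans_diff: "ctrans (A - B) = ctrans A - ctrans B"
  and ctrans_scaleR: "ctrans (r *\<^sub>R A) = r *\<^sub>R ctrans A"
  by (simp_all add: vec_eq_iff)

lemma ctrans_ctrans [simp]: "ctrans (ctrans A) = A"
  by (simp add: vec_eq_iff)

lemma ctrans_mult: "ctrans (A ** B) = ctrans B ** ctrans A"
  by (simp add: vec_eq_iff matrix_matrix_mult_def mult.commute)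

lemma ctrans_one [simp]: "ctrans (mat 1) = mat 1"
  by (simp add: vec_eq_iff mat_def)

lemma det_ctrans: "det (ctrans A) = cnj (det A)" for A :: "'n::finite cmat"
proof -
  have "det (ctrans A) = det (transpose (\<chi> i j. cnj (A $ i $ j)))"
    by (simp add: ctrans_def transpose_def)
  also have "\<dots> = det (\<chi> i j. cnj (A $ i $ j))"
    by (rule det_transpose)
  also have "\<dots> = cnj (det A)"
    by (simp add: det_def)
  finally show ?thesis .
qed

lemma mtrace_mult_comm: "mtrace (A ** B) = mtrace (B ** A)"
  using trace_mul_sym [of A B] by (simp add: trace_def mtrace_def)

lemma mtrace_zero [simp]: "mtrace 0 = 0"
  and mtrace_add: "mtrace (A + B) = mtrace A + mtrace B"
  and mtrace_diff: "mtrace (A - B) = mtrace A - mtrace B"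
  and mtrace_scaleR: "mtrace (r *\<^sub>R A) = r *\<^sub>R mtrace A"
  by (simp_all add: mtrace_def sum.distrib sum_subtractf sum_negf scaleR_sum_right)

lemma SU_iff: "X \<in> SU \<longleftrightarrow> ctrans X ** X = mat 1 \<and> det X = 1"
  unfolding SU_def using matrix_left_right_inverse by blast

lemma SU_inverse:
  assumes "X \<in> SU"
  shows "X ** ctrans X = mat 1" "ctrans X ** X = mat 1"
  using assms by (auto simp: SU_def)

lemma SU_one [simp]: "mat 1 \<in> SU"
  by (simp add: SU_iff)

lemma SU_ctrans: "X \<in> SU \<Longrightarrow> ctrans X \<in> SU"
  by (simp add: SU_def det_ctrans)

lemma SU_cancel_left: "X \<in> SU \<Longrightarrow> ctrans X ** (X ** A) = A" "X \<in> SU \<Longrightarrow> X ** (ctrans X ** A) = A"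
  by (simp_all add: matrix_mul_assoc SU_inverse)

lemma SU_mult: "X \<in> SU \<Longrightarrow> Y \<in> SU \<Longrightarrow> X ** Y \<in> SU"
  by (auto simp: SU_iff [of "X ** Y"] ctrans_mult matrix_mul_assoc [symmetric] SU_cancel_left
      det_mul SU_inverse) (simp add: SU_def)

lemma SU_cancel_right: "X \<in> SU \<Longrightarrow> A ** X ** ctrans X = A" "X \<in> SU \<Longrightarrow> A ** ctrans X ** X = A"
  by (simp_all add: matrix_mul_assoc [symmetric] SU_inverse)

text \<open>The norm of the type is the Frobenius norm. Its trace form makes it invariant under
  multiplication by unitary matrices.\<close>

lemma norm_cmat_squared: "(norm A)\<^sup>2 = Re (mtrace (ctrans A ** A))" for A :: "'n::finite cmat"
proof -
  have "(norm A)\<^sup>2 = (\<Sum>i\<in>UNIV. \<Sum>j\<in>UNIV. (cmod (A $ i $ j))\<^sup>2)"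
    by (simp add: norm_vec_def L2_set_def sum_nonneg)
  also have "\<dots> = (\<Sum>j\<in>UNIV. \<Sum>i\<in>UNIV. (cmod (A $ i $ j))\<^sup>2)"
    by (rule sum.swap)
  also have "\<dots> = Re (mtrace (ctrans A ** A))"
    by (simp add: mtrace_def matrix_matrix_mult_def cmod_power2 flip: power2_eq_square)
  finally show ?thesis .
qed

lemma norm_SU_mult_left: "norm (U ** A) = norm A" if "U \<in> SU" for A :: "'n::finite cmat"
proof -
  have "(norm (U ** A))\<^sup>2 = (norm A)\<^sup>2"
    using that
    by (simp add: norm_cmat_squared ctrans_mult matrix_mul_assoc [symmetric] SU_cancel_left)
  then show ?thesis by (rule power2_eq_imp_eq) simp_all
qed

lemma norm_ctrans [simp]: "norm (ctrans A) = norm A" for A :: "'n::finite cmat"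
proof -
  have "(norm (ctrans A))\<^sup>2 = (norm A)\<^sup>2"
    using mtrace_mult_comm [of A "ctrans A"] by (simp add: norm_cmat_squared)
  then show ?thesis by (simp add: power2_eq_iff_nonneg)
qed

lemma continuous_on_det: "continuous_on S (det :: 'n::finite cmat \<Rightarrow> complex)"
  unfolding det_def by (intro continuous_intros)

lemma compact_SU: "compact (SU :: 'n::finite cmat set)"
proof -
  have eq: "SU = {X. ctrans X ** X = mat 1} \<inter> {X :: 'n cmat. det X = 1}"
    by (auto simp: SU_iff)
  have "closed (SU :: 'n cmat set)"
    unfolding eq
    by (intro closed_Int closed_Collect_eq continuous_intros continuous_on_det
        mm.continuous_on bounded_linear.continuous_on [OF bounded_linear_ctrans] continuous_on_id)
  moreover have "norm X \<le> norm (mat 1 :: 'n cmat)" if "X \<in> SU" for X :: "'n cmat"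
    using norm_SU_mult_left [OF that, of "mat 1"] by simp
  then have "bounded (SU :: 'n cmat set)"
    unfolding bounded_iff by blast
  ultimately show ?thesis by (simp add: compact_eq_bounded_closed)
qed

lemma su_iff: "A \<in> su \<longleftrightarrow> ctrans A = - A \<and> mtrace A = 0"
  by (simp add: su_def)

lemma subspace_su: "subspace (su :: 'n::finite cmat set)"
  by (rule subspaceI) (auto simp: su_iff ctrans_add ctrans_scaleR mtrace_add mtrace_scaleR)

lemma su_conj: "U \<in> SU \<Longrightarrow> A \<in> su \<Longrightarrow> U ** A ** ctrans U \<in> su"
  using mtrace_mult_comm [of "U ** A" "ctrans U"]
  by (simp add: su_iff ctrans_mult mm.minus_left mm.minus_right matrix_mul_assoc SU_inverse)

definition bracket :: "'n::finite cmat \<Rightarrow> 'n cmat \<Rightarrow> 'n cmat" where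
  "bracket A B = A ** B - B ** A"

section \<open>One-parameter groups\<close>

definition mpow :: "'n::finite cmat \<Rightarrow> nat \<Rightarrow> 'n cmat" where
  "mpow A k = ((**) A ^^ k) (mat 1)"

lemma mpow_0 [simp]: "mpow A 0 = mat 1"
  and mpow_Suc: "mpow A (Suc k) = A ** mpow A k"
  by (simp_all add: mpow_def)

lemma mpow_add: "mpow A (j + k) = mpow A j ** mpow A k"
  by (induction j) (simp_all add: mpow_Suc matrix_mul_assoc)

text \<open>Geometric growth of the entries of powers lets the exponential series be dominated by a
  scalar one, entry by entry.\<close>

lemma norm_mpow_le:
  fixes A :: "'n::finite cmat"
  obtains K where "\<And>k. norm (mpow A k $ i $ j) \<le> K ^ k"
proof -
  define a where "a = norm A"
  define K where "K = 1 + real CARD('n) * a"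
  have A: "norm (A $ i $ j) \<le> a" for i j
    unfolding a_def
    using Finite_Cartesian_Product.norm_nth_le [of "A $ i" j] Finite_Cartesian_Product.norm_nth_le [of A i] by linarith
  have a: "a \<ge> 0" by (simp add: a_def)
  have "norm (mpow A k $ i $ j) \<le> K ^ k" for k i j
  proof (induction k arbitrary: i j)
    case 0
    then show ?case by (simp add: mat_def)
  next
    case (Suc k)
    have "norm (mpow A (Suc k) $ i $ j) \<le> (\<Sum>l\<in>UNIV. norm (A $ i $ l * mpow A k $ l $ j))"
      unfolding mpow_Suc matrix_matrix_mult_def by (simp add: norm_sum)
    also have "\<dots> \<le> (\<Sum>l\<in>(UNIV::'n set). a * K ^ k)"
      using Suc A a by (intro sum_mono) (simp add: norm_mult mult_mono)
    also have "\<dots> = (K - 1) * K ^ k" by (simp add: K_def)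
    also have "\<dots> \<le> K ^ Suc k"
      using a by (simp add: K_def algebra_simps)
    finally show ?case .
  qed
  then show ?thesis using that by blast
qed

text \<open>The matrix exponential exp(t A), written entrywise as a power series in \<open>t\<close>
  so that scalar results give convergence and termwise differentiation.\<close>

definition mexp :: "'n::finite cmat \<Rightarrow> real \<Rightarrow> 'n cmat" where
  "mexp A t = (\<chi> i j. \<Sum>k. mpow A k $ i $ j / fact k * of_real t ^ k)"

text \<open>The argument is complex although \<open>mexp\<close> takes real times: the series is
  differentiated over the complex numbers and then restricted to the real line.\<close>

lemma summable_mexp: "summable (\<lambda>k. mpow A k $ i $ j / fact k * (z :: complex) ^ k)"
proof -
  obtain K where K: "\<And>k. norm (mpow A k $ i $ j) \<le> K ^ k"
    using norm_mpow_le by blast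
  have "summable (\<lambda>k. inverse (fact k) * (K * norm z) ^ k)"
    by (rule summable_exp)
  then show ?thesis
  proof (rule summable_comparison_test')
    fix k
    show "norm (mpow A k $ i $ j / fact k * z ^ k) \<le> inverse (fact k) * (K * norm z) ^ k"
      using mult_right_mono [OF K, of "inverse (fact k) * norm z ^ k" k]
      by (simp add: norm_mult norm_divide norm_power power_mult_distrib field_simps)
  qed
qed

lemma mexp_0 [simp]: "mexp A 0 = mat 1"
proof -
  have "(\<Sum>k. mpow A k $ i $ j / fact k * 0 ^ k) = mat 1 $ i $ j" for i j
    using powser_zero [of "\<lambda>k. mpow A k $ i $ j / fact k"] by simp
  then show ?thesis by (simp add: mexp_def vec_eq_iff)
qed

text \<open>A matrix is the sum of its entries pushed through the bounded linear embeddings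
  \<open>axis i\<close>, so differentiability can be checked entrywise.\<close>

lemma has_vector_derivative_cmatI:
  fixes f :: "real \<Rightarrow> 'n::finite cmat"
  assumes "\<And>i j. ((\<lambda>t. f t $ i $ j) has_vector_derivative D $ i $ j) F"
  shows "(f has_vector_derivative D) F"
proof -
  have 1: "bounded_linear (axis i :: 'a \<Rightarrow> 'a::euclidean_space ^ 'n)" for i
    unfolding linear_conv_bounded_linear [symmetric]
    by (rule linearI) (auto simp: vec_eq_iff axis_def)
  have ax: "x = (\<Sum>i\<in>UNIV. axis i (x $ i))" for x :: "'b::euclidean_space ^ 'n"
    by (simp add: vec_eq_iff axis_def sum.delta)
  have *: "x = (\<Sum>i\<in>UNIV. axis i (\<Sum>j\<in>UNIV. axis j (x $ i $ j)))" for x :: "'n cmat"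
    using ax [of x] by (simp add: ax [symmetric])
  have "((\<lambda>t. \<Sum>i\<in>UNIV. axis i (\<Sum>j\<in>UNIV. axis j (f t $ i $ j))) has_vector_derivative
     (\<Sum>i\<in>UNIV. axis i (\<Sum>j\<in>UNIV. axis j (D $ i $ j)))) F"
    by (intro has_vector_derivative_sum bounded_linear.has_vector_derivative [OF 1] assms)
  then show ?thesis using * by simp
qed

lemma mexp_has_vector_derivative:
  "(mexp A has_vector_derivative A ** mexp A t) (at t within S)"
proof (rule has_vector_derivative_cmatI)
  fix i j
  define c where "c k = mpow A k $ i $ j / fact k" for k
  have "((\<lambda>z. \<Sum>k. c k * z ^ k) has_field_derivative (\<Sum>k. diffs c k * (of_real t) ^ k)) (at (of_real t))"
    unfolding c_def by (rule termdiffs_strong_converges_everywhere) (rule summable_mexp)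
  then have "((\<lambda>t. \<Sum>k. c k * of_real t ^ k) has_vector_derivative (\<Sum>k. diffs c k * (of_real t) ^ k)) (at t within S)"
    using has_vector_derivative_real_field by blast
  moreover have "(\<Sum>k. diffs c k * (of_real t) ^ k) = (A ** mexp A t) $ i $ j"
  proof -
    \<comment> \<open>Differentiation shifts the coefficients: the factor \<open>Suc k\<close>
      reduces \<open>fact (Suc k)\<close> to \<open>fact k\<close>, and the surplus factor
      \<open>A\<close> of the power comes out in front.\<close>
    have "diffs c k = (\<Sum>l\<in>UNIV. A $ i $ l * (mpow A k $ l $ j / fact k))" for k
    proof -
      have "diffs c k = mpow A (Suc k) $ i $ j / fact k"
        by (simp add: diffs_def c_def divide_simps del: of_nat_Suc)
      then show ?thesis
        by (simp add: mpow_Suc matrix_matrix_mult_def sum_divide_distrib)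
    qed
    then have "diffs c k * of_real t ^ k =
        (\<Sum>l\<in>UNIV. A $ i $ l * (mpow A k $ l $ j / fact k * of_real t ^ k))" for k
      by (simp add: sum_distrib_right mult.assoc)
    then have "(\<Sum>k. diffs c k * (of_real t) ^ k) =
        (\<Sum>k. \<Sum>l\<in>UNIV. A $ i $ l * (mpow A k $ l $ j / fact k * of_real t ^ k))"
      by simp
    also have "\<dots> = (\<Sum>l\<in>UNIV. \<Sum>k. A $ i $ l * (mpow A k $ l $ j / fact k * of_real t ^ k))"
      by (intro suminf_sum summable_mult summable_mexp)
    also have "\<dots> = (\<Sum>l\<in>UNIV. A $ i $ l * (\<Sum>k. mpow A k $ l $ j / fact k * of_real t ^ k))"
      by (intro sum.cong refl suminf_mult summable_mexp)
    also have "\<dots> = (A ** mexp A t) $ i $ j"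
      by (simp add: matrix_matrix_mult_def mexp_def)
    finally show ?thesis .
  qed
  ultimately show "((\<lambda>t. mexp A t $ i $ j) has_vector_derivative (A ** mexp A t) $ i $ j) (at t within S)"
    by (simp add: mexp_def c_def)
qed

lemma continuous_on_mexp: "continuous_on S (mexp A)"
  by (rule continuous_on_vector_derivative) (rule mexp_has_vector_derivative)

text \<open>Liouville's formula. Differentiating the Leibniz expansion replaces one row at a time by
  the corresponding row of \<open>A ** X t\<close>. That row is a combination of rows of
  \<open>X t\<close>; all but the \<open>i\<close>-th repeat a row and contribute 0, so only the
  diagonal entries of \<open>A\<close> remain.\<close>

lemma has_derivative_det:
  fixes X :: "real \<Rightarrow> 'n::finite cmat"
  assumes X: "(X has_vector_derivative A ** X t) (at t within S)"
  shows "((\<lambda>t. det (X t)) has_vector_derivative mtrace A * det (X t)) (at t within S)"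
proof -
  let ?D = "A ** X t"
  define R where "R i v = (\<chi> k. if k = i then v else X t $ k)" for i and v :: "complex ^ 'n"
  have entry: "((\<lambda>t. X t $ i $ j) has_derivative (\<lambda>h. h *\<^sub>R ?D $ i $ j)) (at t within S)" for i j
    using bounded_linear.has_derivative [OF bounded_linear_compose [OF bounded_linear_vec_nth [of j] bounded_linear_vec_nth [of i]]
        X [unfolded has_vector_derivative_def]] by simp
  have d: "((\<lambda>t. det (X t)) has_derivative
      (\<lambda>h. \<Sum>p\<in>{p. p permutes UNIV}. of_int (sign p) *
         (\<Sum>i\<in>UNIV. (h *\<^sub>R ?D $ i $ p i) * (\<Prod>j\<in>UNIV - {i}. X t $ j $ p j)))) (at t within S)"
    unfolding det_def
    by (intro has_derivative_sum has_derivative_mult_right has_derivative_prod entry)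
  have detR: "det (R i v) = (\<Sum>p\<in>{p. p permutes UNIV}. of_int (sign p) * (v $ p i * (\<Prod>j\<in>UNIV - {i}. X t $ j $ p j)))"
    for i v
  proof -
    have "(\<Prod>k\<in>UNIV. R i v $ k $ p k) = v $ p i * (\<Prod>j\<in>UNIV - {i}. X t $ j $ p j)" for p
    proof -
      have "(\<Prod>k\<in>UNIV. R i v $ k $ p k) = R i v $ i $ p i * (\<Prod>k\<in>UNIV - {i}. R i v $ k $ p k)"
        by (rule prod.remove) auto
      also have "(\<Prod>k\<in>UNIV - {i}. R i v $ k $ p k) = (\<Prod>j\<in>UNIV - {i}. X t $ j $ p j)"
        by (rule prod.cong) (auto simp: R_def)
      finally show ?thesis by (simp add: R_def)
    qed
    then show ?thesis by (simp add: det_def)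
  qed
  have row: "det (R i (?D $ i)) = A $ i $ i * det (X t)" for i
  proof -
    have "?D $ i = (\<Sum>l\<in>UNIV. A $ i $ l *s X t $ l)"
      by (simp add: vec_eq_iff matrix_matrix_mult_def)
    then have "det (R i (?D $ i)) = (\<Sum>l\<in>UNIV. det (R i (A $ i $ l *s X t $ l)))"
      unfolding R_def
      using det_linear_row_sum [OF finite, of i "\<lambda>_ l. A $ i $ l *s X t $ l" UNIV "\<lambda>k. X t $ k"]
      by (simp only:)
    also have "\<dots> = (\<Sum>l\<in>UNIV. A $ i $ l * det (R i (X t $ l)))"
      unfolding R_def
      using det_row_mul [of i "A $ i $ l" "\<lambda>k. X t $ l" "\<lambda>k. X t $ k" for l]
      by (intro sum.cong) auto
    also have "\<dots> = (\<Sum>l\<in>UNIV. if l = i then A $ i $ i * det (X t) else 0)"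
    proof (rule sum.cong)
      fix l
      show "A $ i $ l * det (R i (X t $ l)) = (if l = i then A $ i $ i * det (X t) else 0)"
      proof (cases "l = i")
        case True
        then have "R i (X t $ l) = X t" by (simp add: R_def vec_eq_iff)
        then show ?thesis using True by simp
      next
        case False
        have "det (R i (X t $ l)) = 0"
          by (rule det_identical_rows [OF False]) (use False in \<open>auto simp: R_def row_def vec_eq_iff\<close>)
        then show ?thesis using False by simp
      qed
    qed simp
    finally show ?thesis by simp
  qed
  have "(\<Sum>p\<in>{p. p permutes UNIV}. of_int (sign p) *
         (\<Sum>i\<in>UNIV. (h *\<^sub>R ?D $ i $ p i) * (\<Prod>j\<in>UNIV - {i}. X t $ j $ p j))) =
        h *\<^sub>R (mtrace A * det (X t))" for h
  proof -
    have "(\<Sum>p\<in>{p. p permutes UNIV}. of_int (sign p) *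
         (\<Sum>i\<in>UNIV. (h *\<^sub>R ?D $ i $ p i) * (\<Prod>j\<in>UNIV - {i}. X t $ j $ p j))) =
         (\<Sum>p\<in>{p. p permutes UNIV}. \<Sum>i\<in>UNIV. h *\<^sub>R (of_int (sign p) *
         (?D $ i $ p i * (\<Prod>j\<in>UNIV - {i}. X t $ j $ p j))))"
      by (simp add: sum_distrib_left scaleR_sum_right)
    also have "\<dots> = (\<Sum>i\<in>UNIV. \<Sum>p\<in>{p. p permutes UNIV}. h *\<^sub>R (of_int (sign p) *
         (?D $ i $ p i * (\<Prod>j\<in>UNIV - {i}. X t $ j $ p j))))"
      by (rule sum.swap)
    also have "\<dots> = (\<Sum>i\<in>UNIV. h *\<^sub>R det (R i (?D $ i)))"
      by (simp add: detR scaleR_sum_right)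
    also have "\<dots> = h *\<^sub>R (mtrace A * det (X t))"
      unfolding row by (simp add: mtrace_def scaleR_sum_right sum_distrib_right)
    finally show ?thesis .
  qed
  with d show ?thesis by (simp add: has_vector_derivative_def)
qed

lemma vector_derivative_zero_imp_constant:
  fixes f :: "real \<Rightarrow> 'a::banach"
  assumes "\<And>t. (f has_vector_derivative 0) (at t)"
  shows "f t = f s"
proof -
  obtain c where "\<And>x. x \<in> UNIV \<Longrightarrow> f x = c"
    using has_vector_derivative_zero_constant [of UNIV f] assms by auto
  then show ?thesis by simp
qed

lemma has_vector_derivative_matrix_mult:
  fixes f g :: "real \<Rightarrow> 'n::finite cmat"
  assumes "(f has_vector_derivative f') (at t within S)" "(g has_vector_derivative g') (at t within S)"
  shows "((\<lambda>t. f t ** g t) has_vector_derivative f t ** g' + f' ** g t) (at t within S)"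
  by (rule bounded_bilinear.has_vector_derivative [OF bounded_bilinear_matrix_mult assms])

lemma has_vector_derivative_ctrans:
  assumes "(f has_vector_derivative f') (at t within S)"
  shows "((\<lambda>t. ctrans (f t)) has_vector_derivative ctrans f') (at t within S)"
  by (rule bounded_linear.has_vector_derivative [OF bounded_linear_ctrans assms])

text \<open>The two terms of the product rule cancel because \<open>A\<close> is skew-Hermitian.
  This conservation law gives unitarity of \<open>mexp\<close>, uniqueness of solutions, and later
  the invariance of \<open>sharp\<close>. It is pointwise in \<open>t\<close>, so \<open>A\<close>
  may vary with time.\<close>

lemma adjoint_solutions_product_constant:
  fixes X Y :: "real \<Rightarrow> 'n::finite cmat"
  assumes A: "A \<in> su"
    and X: "(X has_vector_derivative A ** X t) (at t within S)"
    and Y: "(Y has_vector_derivative A ** Y t) (at t within S)"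
  shows "((\<lambda>t. ctrans (X t) ** Y t) has_vector_derivative 0) (at t within S)"
  using has_vector_derivative_matrix_mult [OF has_vector_derivative_ctrans [OF X] Y] A
  by (simp add: su_iff ctrans_mult mm.minus_left mm.minus_right matrix_mul_assoc)

lemma mexp_unitary:
  assumes "A \<in> su"
  shows "ctrans (mexp A t) ** mexp A t = mat 1"
  using vector_derivative_zero_imp_constant [of "\<lambda>t. ctrans (mexp A t) ** mexp A t" t 0]
    adjoint_solutions_product_constant [OF assms mexp_has_vector_derivative mexp_has_vector_derivative]
  by simp

lemma mexp_SU:
  assumes "A \<in> su"
  shows "mexp A t \<in> SU"
proof -
  have "det (mexp A t) = det (mexp A 0)"
    using has_derivative_det [OF mexp_has_vector_derivative, of A _ UNIV] assms
    by (intro vector_derivative_zero_imp_constant) (simp add: su_iff)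
  then show ?thesis using mexp_unitary [OF assms] by (simp add: SU_iff)
qed

text \<open>Uniqueness of solutions: \<open>ctrans (mexp A t) ** X t\<close> is conserved and
  \<open>mexp A t\<close> is unitary.\<close>

lemma solution_eq_mexp:
  fixes X :: "real \<Rightarrow> 'n::finite cmat"
  assumes A: "A \<in> su" and X: "\<And>t. (X has_vector_derivative A ** X t) (at t)"
  shows "X t = mexp A t ** X 0"
proof -
  have "ctrans (mexp A t) ** X t = ctrans (mexp A 0) ** X 0"
    using adjoint_solutions_product_constant [OF A mexp_has_vector_derivative X]
    by (intro vector_derivative_zero_imp_constant) simp
  then have "mexp A t ** (ctrans (mexp A t) ** X t) = mexp A t ** X 0"
    by simp
  then show ?thesis by (simp add: SU_cancel_left mexp_SU A)
qed

lemma mexp_add: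
  assumes A: "A \<in> su"
  shows "mexp A (s + t) = mexp A s ** mexp A t"
proof -
  have "((\<lambda>s. mexp A (s + t)) has_vector_derivative A ** mexp A (s + t)) (at s)" for s
    using vector_diff_chain_at [of "\<lambda>s. s + t" 1 s "mexp A" "A ** mexp A (s + t)"]
    by (simp add: mexp_has_vector_derivative o_def has_vector_derivative_add_const)
  from solution_eq_mexp [OF A this] show ?thesis by simp
qed

lemma mexp_mpow:
  assumes A: "A \<in> su"
  shows "mexp A (of_nat k * t) = mpow (mexp A t) k"
proof (induction k)
  case (Suc k)
  have "real (Suc k) * t = t + real k * t" by (simp add: algebra_simps)
  then have "mexp A (real (Suc k) * t) = mexp A t ** mexp A (real k * t)"
    using mexp_add [OF A] by metis
  then show ?case by (simp add: mpow_Suc Suc)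
qed simp

section \<open>Semigroups generated by one-parameter groups\<close>

text \<open>Times are nonnegative because the drift cannot be run backwards. Factors are added on
  the left, as when a trajectory is prolonged.\<close>

inductive_set exp_semigroup :: "'n::finite cmat set \<Rightarrow> 'n cmat set" for WW where
  one: "mat 1 \<in> exp_semigroup WW"
| step: "Z \<in> exp_semigroup WW \<Longrightarrow> W \<in> WW \<Longrightarrow> t \<ge> 0 \<Longrightarrow> mexp W t ** Z \<in> exp_semigroup WW"

lemma exp_semigroup_SU: "X \<in> exp_semigroup WW \<Longrightarrow> WW \<subseteq> su \<Longrightarrow> X \<in> SU"
  by (induction rule: exp_semigroup.induct) (auto intro: SU_mult mexp_SU)

lemma exp_semigroup_mult:
  "X \<in> exp_semigroup WW \<Longrightarrow> Y \<in> exp_semigroup WW \<Longrightarrow> X ** Y \<in> exp_semigroup WW"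
  by (induction rule: exp_semigroup.induct)
    (auto simp: matrix_mul_assoc [symmetric] intro: exp_semigroup.step)

lemma mexp_in_exp_semigroup: "W \<in> WW \<Longrightarrow> t \<ge> 0 \<Longrightarrow> mexp W t \<in> exp_semigroup WW"
  using exp_semigroup.step [OF exp_semigroup.one] by force

lemma mpow_in_exp_semigroup: "X \<in> exp_semigroup WW \<Longrightarrow> mpow X k \<in> exp_semigroup WW"
  by (induction k) (auto simp: mpow_Suc intro: exp_semigroup_mult exp_semigroup.one)

section \<open>Lie subalgebras and the span of conjugated generators\<close>

definition lie_subalgebra :: "'n::finite cmat set \<Rightarrow> bool" where
  "lie_subalgebra L \<longleftrightarrow> subspace L \<and> (\<forall>A\<in>L. \<forall>B\<in>L. bracket A B \<in> L)"

text \<open>The Jacobi identity as ad [A,B] = [ad A, ad B]: the matrices whose ad preserves a given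
  subspace are closed under brackets.\<close>

lemma bracket_jacobi: "bracket (bracket A B) Y = bracket A (bracket B Y) - bracket B (bracket A Y)"
  by (simp add: bracket_def mm.diff_left mm.diff_right matrix_mul_assoc)

lemma bracket_linear:
  "bracket 0 Y = 0" "bracket Y 0 = 0"
  "bracket (A + B) Y = bracket A Y + bracket B Y" "bracket Y (A + B) = bracket Y A + bracket Y B"
  "bracket (r *\<^sub>R A) Y = r *\<^sub>R bracket A Y" "bracket Y (r *\<^sub>R A) = r *\<^sub>R bracket Y A"
  by (simp_all add: bracket_def mm.add_left mm.add_right mm.scaleR_left mm.scaleR_right mm.zero_left
      mm.zero_right scaleR_diff_right)

text \<open>Difference quotients lie in \<open>V\<close>, which is closed. The derivative is
  one-sided because the semigroup offers only times \<open>t \<ge> 0\<close>.\<close>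

lemma right_derivative_in_subspace:
  fixes f :: "real \<Rightarrow> 'a::euclidean_space"
  assumes V: "subspace V" and f: "\<And>t. t \<ge> 0 \<Longrightarrow> f t \<in> V"
    and D: "(f has_vector_derivative D) (at 0 within {0..})"
  shows "D \<in> V"
proof -
  have "((\<lambda>y. (1 / norm (y - 0)) *\<^sub>R (f y - (f 0 + (y - 0) *\<^sub>R D))) \<longlongrightarrow> 0) (at 0 within {0..})"
    using D unfolding has_vector_derivative_def has_derivative_within by blast
  then have "((\<lambda>y. (1 / norm (y - 0)) *\<^sub>R (f y - (f 0 + (y - 0) *\<^sub>R D)) + D) \<longlongrightarrow> 0 + D) (at 0 within {0..})"
    by (intro tendsto_add tendsto_const)
  moreover have "\<forall>\<^sub>F y in at 0 within {0..}.
      (1 / norm (y - 0)) *\<^sub>R (f y - (f 0 + (y - 0) *\<^sub>R D)) + D \<in> V"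
    unfolding eventually_at_filter
  proof (rule always_eventually, intro allI impI)
    fix y :: real
    assume y: "y \<noteq> 0" "y \<in> {0..}"
    then have "(1 / norm (y - 0)) *\<^sub>R (f y - (f 0 + (y - 0) *\<^sub>R D)) + D = (1 / y) *\<^sub>R (f y - f 0)"
      by (simp add: algebra_simps)
    then show "(1 / norm (y - 0)) *\<^sub>R (f y - (f 0 + (y - 0) *\<^sub>R D)) + D \<in> V"
      using y f V by (simp add: subspace_scale subspace_diff)
  qed
  moreover have "at (0::real) within {0..} \<noteq> bot"
    by (simp add: at_within_Ici_at_right)
  ultimately have "0 + D \<in> V"
    by (intro Lim_in_closed_set [OF closed_subspace [OF V]])
  then show ?thesis by simp
qed

text \<open>Differentiating exp(t W) Y exp(-t W) from the right at 0 shows that the span of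
  conjugates is invariant under ad \<open>W\<close> for every generator \<open>W\<close>.\<close>

lemma span_conjugates_eq_su:
  assumes WW: "WW \<subseteq> su"
    and gen: "\<And>L. lie_subalgebra L \<Longrightarrow> WW \<subseteq> L \<Longrightarrow> su \<subseteq> L"
  shows "su \<subseteq> span {r ** W ** ctrans r | r W. r \<in> exp_semigroup WW \<and> W \<in> WW}"
    (is "su \<subseteq> span ?G")
proof -
  have ad: "bracket W Y \<in> span ?G" if W: "W \<in> WW" and Y: "Y \<in> span ?G" for W Y
  proof -
    have "span ?G \<subseteq> {Y. bracket W Y \<in> span ?G}"
    proof (rule span_minimal)
      show "subspace {Y. bracket W Y \<in> span ?G}"
        by (rule subspaceI) (auto simp: bracket_linear intro: span_zero span_add span_scale)
      show "?G \<subseteq> {Y. bracket W Y \<in> span ?G}"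
      proof clarify
        fix r W'
        assume r: "r \<in> exp_semigroup WW" and W': "W' \<in> WW"
        define Y where "Y = r ** W' ** ctrans r"
        define f where "f t = mexp W t ** (Y ** ctrans (mexp W t))" for t
        have "f t \<in> span ?G" if "t \<ge> 0" for t
        proof -
          have "f t = (mexp W t ** r) ** W' ** ctrans (mexp W t ** r)"
            by (simp add: f_def Y_def ctrans_mult matrix_mul_assoc)
          then show ?thesis
            using exp_semigroup.step [OF r W that] W' by (auto intro!: span_base)
        qed
        moreover have "(f has_vector_derivative bracket W Y) (at 0 within {0..})"
        proof -
          have "(f has_vector_derivative mexp W 0 ** (Y ** ctrans (W ** mexp W 0) + 0 ** ctrans (mexp W 0))
              + (W ** mexp W 0) ** (Y ** ctrans (mexp W 0))) (at 0 within {0..})"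
            unfolding f_def
            by (intro has_vector_derivative_matrix_mult has_vector_derivative_ctrans
                mexp_has_vector_derivative has_vector_derivative_const)
          moreover have "ctrans W = - W" using W WW by (auto simp: su_iff)
          ultimately show ?thesis
            by (simp add: bracket_def mm.minus_right mm.zero_left)
        qed
        ultimately have "bracket W Y \<in> span ?G"
          using right_derivative_in_subspace [OF subspace_span, of f] by simp
        then show "bracket W (r ** W' ** ctrans r) \<in> span ?G"
          by (simp only: Y_def)
      qed
    qed
    with Y show ?thesis by blast
  qed
  define L where "L = {A \<in> span ?G. \<forall>Y\<in>span ?G. bracket A Y \<in> span ?G}"
  have "lie_subalgebra L"
    unfolding lie_subalgebra_def L_def
    by (intro conjI subspaceI)
      (auto simp: bracket_linear bracket_jacobi intro: span_zero span_add span_scale span_diff)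
  moreover have "WW \<subseteq> L"
  proof
    fix W
    assume W: "W \<in> WW"
    then have "W \<in> ?G" by (force intro: exp_semigroup.one)
    then show "W \<in> L" using ad [OF W] by (auto simp: L_def intro: span_base)
  qed
  ultimately have "su \<subseteq> L" by (rule gen)
  then show ?thesis by (auto simp: L_def)
qed

text \<open>\<open>Ys\<close> are directions, translated to the identity, in which \<open>p\<close> can be perturbed inside the semigroup.
  The perturbation is driven by a matrix \<open>M\<close> through arbitrary linear functionals \<open>s\<close>, so that the open mapping
  theorem can later be applied on the space of matrices itself.\<close>

definition steerable :: "'n::finite cmat set \<Rightarrow> 'n cmat set \<Rightarrow> 'n cmat \<Rightarrow> bool" where
  "steerable WW Ys p \<longleftrightarrow> p \<in> exp_semigroup WW \<and>
     (\<forall>s :: 'n cmat \<Rightarrow> 'n cmat \<Rightarrow> real. (\<forall>Y\<in>Ys. bounded_linear (s Y)) \<longrightarrow>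
       (\<exists>F :: 'n cmat \<Rightarrow> 'n cmat. continuous_on UNIV F \<and> F 0 = p \<and>
         (F has_derivative (\<lambda>M. (\<Sum>Y\<in>Ys. s Y M *\<^sub>R Y) ** p)) (at 0) \<and>
         (\<forall>M. (\<forall>Y\<in>Ys. \<bar>s Y M\<bar> \<le> 1) \<longrightarrow> F M \<in> exp_semigroup WW)))"

lemma steerable_empty: "steerable WW {} (mat 1)"
  unfolding steerable_def
  by (auto simp: mm.zero_left exp_semigroup.one intro!: exI [of _ "\<lambda>_. mat 1"])

text \<open>Appending \<open>r ** mexp W (1 + s Y M)\<close> on the right keeps the old directions
  and adds \<open>Y\<close>, because \<open>Y ** (p ** r) = p ** r ** W\<close>. The base time 1
  leaves room for perturbations of size at most 1 in either direction.\<close>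

lemma steerable_insert:
  assumes WW: "WW \<subseteq> su" and st: "steerable WW Ys p" and fin: "finite Ys"
    and r: "r \<in> exp_semigroup WW" and W: "W \<in> WW"
    and Y: "Y = p ** r ** W ** ctrans (p ** r)" "Y \<notin> Ys"
  shows "steerable WW (insert Y Ys) (p ** (r ** mexp W 1))"
  unfolding steerable_def
proof (intro conjI allI impI)
  have p: "p \<in> exp_semigroup WW" using st by (simp add: steerable_def)
  then have pr: "p ** r \<in> SU" using r WW exp_semigroup_SU exp_semigroup_mult by blast
  show "p ** (r ** mexp W 1) \<in> exp_semigroup WW"
    using p r W by (intro exp_semigroup_mult mexp_in_exp_semigroup) auto
  fix s :: "'a cmat \<Rightarrow> 'a cmat \<Rightarrow> real"
  assume s: "\<forall>Y\<in>insert Y Ys. bounded_linear (s Y)"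
  then obtain F where F: "continuous_on UNIV F" "F 0 = p"
      "(F has_derivative (\<lambda>M. (\<Sum>Y\<in>Ys. s Y M *\<^sub>R Y) ** p)) (at 0)"
      "\<And>M. (\<forall>Y\<in>Ys. \<bar>s Y M\<bar> \<le> 1) \<Longrightarrow> F M \<in> exp_semigroup WW"
    using st by (auto simp: steerable_def)
  have sY: "bounded_linear (s Y)" using s by blast
  then have s0: "s Y 0 = 0" by (simp add: bounded_linear.linear linear_0)
  define E where "E = mexp W 1"
  define F' where "F' M = F M ** (r ** mexp W (1 + s Y M))" for M
  have "continuous_on UNIV F'"
  proof -
    have "continuous_on UNIV (\<lambda>M. mexp W (1 + s Y M))"
      using continuous_on_mexp [of UNIV W]
      by (rule continuous_on_compose2)
        (auto intro!: continuous_intros bounded_linear.continuous_on [OF sY])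
    then show ?thesis
      unfolding F'_def by (intro mm.continuous_on F continuous_on_const)
  qed
  moreover have "F' 0 = p ** (r ** mexp W 1)" by (simp add: F'_def F s0)
  moreover have "(F' has_derivative (\<lambda>M. (\<Sum>Y\<in>insert Y Ys. s Y M *\<^sub>R Y) ** (p ** (r ** mexp W 1)))) (at 0)"
  proof -
    have 1: "((\<lambda>M. 1 + s Y M) has_derivative (\<lambda>h. 0 + s Y h)) (at 0)"
      using sY by (intro has_derivative_add has_derivative_const bounded_linear_imp_has_derivative)
    have 2: "((\<lambda>M. mexp W (1 + s Y M)) has_derivative (\<lambda>h. (0 + s Y h) *\<^sub>R (W ** E))) (at 0)"
      using has_derivative_compose [OF 1, of "mexp W" "\<lambda>h. h *\<^sub>R (W ** E)"]
        mexp_has_vector_derivative [of W 1 UNIV]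
      by (simp add: s0 has_vector_derivative_def E_def)
    have "(F' has_derivative (\<lambda>h. F 0 ** (r ** ((0 + s Y h) *\<^sub>R (W ** E)) + 0 ** mexp W (1 + s Y 0))
        + ((\<Sum>Y\<in>Ys. s Y h *\<^sub>R Y) ** p) ** (r ** mexp W (1 + s Y 0)))) (at 0)"
      unfolding F'_def by (intro mm.FDERIV 2 F has_derivative_const)
    moreover have "F 0 ** (r ** ((0 + s Y h) *\<^sub>R (W ** E)) + 0 ** mexp W (1 + s Y 0))
        + ((\<Sum>Y\<in>Ys. s Y h *\<^sub>R Y) ** p) ** (r ** mexp W (1 + s Y 0)) =
        (\<Sum>Y\<in>insert Y Ys. s Y h *\<^sub>R Y) ** (p ** (r ** mexp W 1))" for h
    proof -
      have "Y ** (p ** (r ** E)) = p ** r ** W ** (ctrans (p ** r) ** ((p ** r) ** E))"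
        by (simp add: Y(1) matrix_mul_assoc)
      also have "\<dots> = p ** (r ** (W ** E))"
        unfolding SU_cancel_left [OF pr] by (simp add: matrix_mul_assoc)
      finally have "Y ** (p ** (r ** E)) = p ** (r ** (W ** E))" .
      then show ?thesis
        using fin Y(2)
        by (simp add: s0 F(2) mm.zero_left mm.add_left mm.scaleR_left mm.scaleR_right
            flip: E_def) (simp add: matrix_mul_assoc)
    qed
    ultimately show ?thesis by simp
  qed
  moreover have "F' M \<in> exp_semigroup WW" if "\<forall>Y\<in>insert Y Ys. \<bar>s Y M\<bar> \<le> 1" for M
  proof -
    have "1 + s Y M \<ge> 0" using that by (auto simp: abs_le_iff)
    then show ?thesis
      unfolding F'_def using that
      by (intro exp_semigroup_mult F r mexp_in_exp_semigroup W) auto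
  qed
  ultimately show "\<exists>F. continuous_on UNIV F \<and> F 0 = p ** (r ** mexp W 1) \<and>
         (F has_derivative (\<lambda>M. (\<Sum>Y\<in>insert Y Ys. s Y M *\<^sub>R Y) ** (p ** (r ** mexp W 1)))) (at 0) \<and>
         (\<forall>M. (\<forall>Y\<in>insert Y Ys. \<bar>s Y M\<bar> \<le> 1) \<longrightarrow> F M \<in> exp_semigroup WW)"
    by blast
qed

text \<open>While \<open>span Ys\<close> fails to contain \<open>su\<close>, some conjugate of a
  generator lies outside it and extends \<open>Ys\<close>. Independent families would then exist in
  every cardinality, beyond the dimension of the matrix space.\<close>

lemma steerable_basis_exists:
  fixes WW :: "'n::finite cmat set"
  assumes WW: "WW \<subseteq> su"
    and gen: "\<And>L. lie_subalgebra L \<Longrightarrow> WW \<subseteq> L \<Longrightarrow> su \<subseteq> L"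
  obtains Ys p where "steerable WW Ys p" "independent Ys" "su \<subseteq> span Ys"
proof (rule ccontr)
  assume "\<not> thesis"
  with that have none: "\<not> su \<subseteq> span Ys" if "steerable WW Ys p" "independent Ys" for Ys p
    using that by blast
  have "\<exists>Ys p. steerable WW Ys p \<and> independent Ys \<and> card Ys = k" for k
  proof (induction k)
    case 0
    then show ?case using steerable_empty independent_empty by force
  next
    case (Suc k)
    then obtain Ys p where Ys: "steerable WW Ys p" "independent Ys" "card Ys = k" by blast
    have fin: "finite Ys" using Ys(2) by (simp add: independent_imp_finite)
    have p: "p \<in> SU" using Ys(1) WW exp_semigroup_SU by (auto simp: steerable_def)
    have "\<exists>r\<in>exp_semigroup WW. \<exists>W\<in>WW. p ** r ** W ** ctrans (p ** r) \<notin> span Ys"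
    proof (rule ccontr)
      assume "\<not> ?thesis"
      then have *: "p ** r ** W ** ctrans (p ** r) \<in> span Ys" if "r \<in> exp_semigroup WW" "W \<in> WW" for r W
        using that by blast
      \<comment> \<open>Conjugation by \<open>p\<close> carries the span of conjugates, which
        contains \<open>su\<close>, into \<open>span Ys\<close>. Since this conjugation maps
        \<open>su\<close> onto itself, \<open>su\<close> would lie in
        \<open>span Ys\<close>.\<close>
      have "span {r ** W ** ctrans r | r W. r \<in> exp_semigroup WW \<and> W \<in> WW}
          \<subseteq> {A. p ** A ** ctrans p \<in> span Ys}"
      proof (rule span_minimal)
        show "subspace {A. p ** A ** ctrans p \<in> span Ys}"
          by (rule subspaceI) (auto simp: mm.zero_left mm.zero_right mm.add_left mm.add_right
              mm.scaleR_left mm.scaleR_right intro: span_zero span_add span_scale)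
        show "{r ** W ** ctrans r | r W. r \<in> exp_semigroup WW \<and> W \<in> WW}
            \<subseteq> {A. p ** A ** ctrans p \<in> span Ys}"
          using * by (auto simp: ctrans_mult matrix_mul_assoc)
      qed
      then have sub: "su \<subseteq> {A. p ** A ** ctrans p \<in> span Ys}"
        using span_conjugates_eq_su [OF WW gen] by blast
      have "su \<subseteq> span Ys"
      proof
        fix A :: "'n cmat"
        assume "A \<in> su"
        then have "ctrans p ** A ** p \<in> su"
          using su_conj [OF SU_ctrans [OF p], of A] by simp
        then have "p ** (ctrans p ** A ** p) ** ctrans p \<in> span Ys" using sub by blast
        then show "A \<in> span Ys"
          by (simp add: matrix_mul_assoc SU_inverse [OF p] SU_cancel_right [OF p])
      qed
      then show False using none Ys by blast
    qed
    then obtain r W where r: "r \<in> exp_semigroup WW" and W: "W \<in> WW"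
      and n: "p ** r ** W ** ctrans (p ** r) \<notin> span Ys" by blast
    define Y where "Y = p ** r ** W ** ctrans (p ** r)"
    have nY: "Y \<notin> Ys" using n span_base Y_def by metis
    have "steerable WW (insert Y Ys) (p ** (r ** mexp W 1))"
      by (rule steerable_insert [OF WW Ys(1) fin r W Y_def nY])
    moreover have "independent (insert Y Ys)"
      using n Ys(2) by (simp add: Y_def independent_insert)
    moreover have "card (insert Y Ys) = Suc k" using fin nY Ys by simp
    ultimately show ?case by blast
  qed
  from this [of "Suc DIM('n cmat)"] obtain Ys :: "'n cmat set"
    where "independent Ys" "card Ys = Suc DIM('n cmat)" by blast
  then show False using independent_bound [of Ys] by simp
qed

section \<open>The semigroup has interior\<close>

lemma mat_nth: "mat c $ i $ j = (if i = j then c else 0)"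
  by (simp add: mat_def)

lemma mat_mult_nth: "(mat c ** A) $ i $ j = c * A $ i $ j" "(A ** mat c) $ i $ j = c * A $ i $ j"
  for A :: "'n::finite cmat"
  by (simp_all add: matrix_matrix_mult_def mat_def if_distrib [of "\<lambda>x. x * _"] if_distrib [of "\<lambda>x. _ * x"]
      cong: if_cong)

lemma norm_mat_mult: "norm (mat c ** A) = norm c * norm A" for A :: "'n::finite cmat"
proof -
  have "(norm (mat c ** A))\<^sup>2 = (norm c * norm A)\<^sup>2"
    by (simp add: norm_vec_def L2_set_def mat_mult_nth norm_mult power_mult_distrib sum_nonneg
        sum_distrib_left)
  then show ?thesis by (rule power2_eq_imp_eq) simp_all
qed

text \<open>With \<open>a\<close>, \<open>b\<close> the roots of \<open>z\<^sup>2 - c z - 1\<close>, unitarity reads \<open>(P - a)(P - b) = 0\<close>. Since \<open>a b = -1\<close>,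
  one root, say \<open>b\<close>, is far from 1, which makes \<open>P - b\<close> invertible and \<open>P = a\<close> scalar.\<close>

lemma SU_near_one_rigid:
  obtains \<epsilon> where "\<epsilon> > 0"
    "\<And>(P :: 'n::finite cmat) c. P \<in> SU \<Longrightarrow> P - ctrans P = mat c \<Longrightarrow> norm (P - mat 1) < \<epsilon> \<Longrightarrow> P = mat 1"
proof -
  have "\<exists>K>0. \<forall>(A :: 'n cmat) (B :: 'n cmat). norm (A ** B) \<le> norm A * norm B * K"
    by (rule mm.pos_bounded)
  then obtain K where K: "K > 0" "\<And>(A :: 'n cmat) (B :: 'n cmat). norm (A ** B) \<le> norm A * norm B * K"
    by auto
  have "finite {z :: complex. z ^ CARD('n) = 1}"
    by (rule card_ge_0_finite) (simp add: card_complex_roots_unity Suc_le_eq)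
  \<comment> \<open>A scalar matrix in \<open>SU\<close> is an n-th root of unity. The distance
    \<open>d\<close> separates 1 from all other such roots.\<close>
  then obtain d where d: "d > 0" "\<And>z :: complex. z ^ CARD('n) = 1 \<Longrightarrow> z \<noteq> 1 \<Longrightarrow> d \<le> dist 1 z"
    using finite_set_avoid [of "{z :: complex. z ^ CARD('n) = 1}" 1] by blast
  define \<epsilon> where "\<epsilon> = min (1 / K) d"
  show thesis
  proof
    show "\<epsilon> > 0" using K d by (simp add: \<epsilon>_def)
    fix P :: "'n cmat" and c
    assume P: "P \<in> SU" and c: "P - ctrans P = mat c" and e: "norm (P - mat 1) < \<epsilon>"
    have scalar: "P = mat 1"
      if ab: "a + b = c" "a * b = - 1" "Re b \<le> 0" for a b
    proof -
      define N where "N = P - mat a"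
      have "ctrans P = P - mat c" using c by (simp add: algebra_simps)
      then have "P ** P - P ** mat c = mat 1"
        using SU_inverse(1) [OF P] by (simp add: mm.diff_right)
      then have PP: "P ** P = mat 1 + P ** mat c" by (simp add: algebra_simps)
      have "P ** N = mat b ** N"
      proof -
        have "P ** N = mat 1 + P ** mat c - P ** mat a"
          by (simp add: N_def mm.diff_right PP)
        moreover have "(mat 1 + P ** mat c - P ** mat a) $ i $ j = (mat b ** N) $ i $ j" for i j
          using ab(2) by (auto simp: mat_mult_nth N_def mat_nth ab(1) [symmetric] algebra_simps)
        ultimately show ?thesis by (simp add: vec_eq_iff)
      qed
      then have "(P - mat 1) ** N = mat (b - 1) ** N"
        by (simp add: mm.diff_left vec_eq_iff mat_mult_nth algebra_simps)
      then have "norm (b - 1) * norm N \<le> norm (P - mat 1) * norm N * K"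
        using K(2) [of "P - mat 1" N] by (simp add: norm_mat_mult)
      moreover have "norm (b - 1) \<ge> 1"
        using abs_Re_le_cmod [of "b - 1"] ab(3) by simp
      moreover have "norm (P - mat 1) * K < 1"
        using e K(1) by (simp add: \<epsilon>_def field_simps)
      ultimately have "norm N = 0"
      proof -
        assume 1: "norm (b - 1) * norm N \<le> norm (P - mat 1) * norm N * K"
          and 2: "norm (b - 1) \<ge> 1" and 3: "norm (P - mat 1) * K < 1"
        have "1 * norm N \<le> norm (b - 1) * norm N" using 2 by (intro mult_right_mono) auto
        then have "norm N \<le> (norm (P - mat 1) * K) * norm N"
          using 1 by (simp add: mult_ac)
        then show ?thesis
          using 3 mult_strict_right_mono [OF 3, of "norm N"] norm_ge_zero [of N] by linarith
      qed
      then have Pa: "P = mat a" by (simp add: N_def)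
      have "det P = a ^ CARD('n)"
        unfolding Pa by (subst det_diagonal) (auto simp: mat_nth)
      then have "a ^ CARD('n) = 1" using P by (simp add: SU_def)
      moreover have "dist 1 a < d"
      proof -
        have "norm ((P - mat 1) $ i $ i) \<le> norm (P - mat 1)" for i
          using Finite_Cartesian_Product.norm_nth_le [of "(P - mat 1) $ i" i]
            Finite_Cartesian_Product.norm_nth_le [of "P - mat 1" i] by linarith
        then show ?thesis
          using e unfolding Pa \<epsilon>_def by (simp add: mat_def dist_norm norm_minus_commute)
      qed
      ultimately have "a = 1" using d(2) by force
      then show "P = mat 1" using Pa by simp
    qed
    define a where "a = (c + csqrt (c\<^sup>2 + 4)) / 2"
    define b where "b = (c - csqrt (c\<^sup>2 + 4)) / 2"
    have ab: "a + b = c" by (simp add: a_def b_def field_simps)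
    have "(c + q) / 2 * ((c - q) / 2) = (c\<^sup>2 - q\<^sup>2) / 4" for q
      by (simp add: power2_eq_square field_simps)
    then have "a * b = (c\<^sup>2 - (csqrt (c\<^sup>2 + 4))\<^sup>2) / 4"
      unfolding a_def b_def .
    then have m: "a * b = - 1" by simp
    \<comment> \<open>If both real parts were positive, the vanishing imaginary part of a b would
      give \<open>Im a * Im b \<le> 0\<close>, and the real part of a b would be positive instead of
      -1.\<close>
    have "Re a \<le> 0 \<or> Re b \<le> 0"
    proof (rule ccontr)
      assume *: "\<not> ?thesis"
      have re: "Re a * Re b - Im a * Im b = -1" and "Re a * Im b + Im a * Re b = 0"
        using arg_cong [OF m, of Re] arg_cong [OF m, of Im] by simp_all
      then have "Re a * (Im a * Im b) = - ((Im a * Im a) * Re b)"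
        by algebra
      also have "\<dots> \<le> 0" using * by simp
      finally have "Im a * Im b \<le> 0"
        using * by (simp add: mult_le_0_iff)
      moreover have "Re a * Re b > 0" using * by simp
      ultimately show False using re by linarith
    qed
    then show "P = mat 1"
      using scalar [of a b] scalar [of b a] ab m by (auto simp: add.commute mult.commute)
  qed
qed

text \<open>The orthogonal projection onto \<open>su\<close> for the Frobenius inner product: the
  skew-Hermitian part with its trace removed.\<close>

definition su_part :: "'n::finite cmat \<Rightarrow> 'n cmat" where
  "su_part M = (1 / 2) *\<^sub>R (M - ctrans M - mat (mtrace (M - ctrans M) / of_nat CARD('n)))"

lemma mtrace_mat: "mtrace (mat c :: 'n::finite cmat) = of_nat CARD('n) * c"
  by (simp add: mtrace_def mat_def)

lemma ctrans_mat: "ctrans (mat c) = mat (cnj c)"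
  by (simp add: vec_eq_iff mat_def)

lemma mtrace_ctrans: "mtrace (ctrans A) = cnj (mtrace A)"
  by (simp add: mtrace_def)

lemma su_part_su: "su_part M \<in> su"
proof -
  let ?c = "mtrace (M - ctrans M) / of_nat CARD('a)"
  have "cnj ?c = - ?c" by (simp add: mtrace_ctrans mtrace_diff field_simps)
  then have "ctrans (su_part M) = - su_part M"
    by (simp add: su_part_def ctrans_scaleR ctrans_diff ctrans_mat)
      (simp add: vec_eq_iff mat_def algebra_simps)
  moreover have "mtrace (su_part M) = 0"
    by (simp add: su_part_def mtrace_scaleR mtrace_diff mtrace_mat)
  ultimately show ?thesis by (simp add: su_iff)
qed

text \<open>Displacements complementary to \<open>su\<close> have scalar skew part, which is the
  hypothesis of \<open>SU_near_one_rigid\<close>.\<close>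

lemma su_part_complement:
  "\<exists>c. (M - su_part M) - ctrans (M - su_part M) = mat c"
proof -
  have "ctrans (su_part M) = - su_part M" using su_part_su [of M] by (simp add: su_iff)
  then have "(M - su_part M) - ctrans (M - su_part M) = M - ctrans M - 2 *\<^sub>R su_part M"
    by (simp add: ctrans_diff scaleR_2)
  also have "\<dots> = mat (mtrace (M - ctrans M) / of_nat CARD('a))"
    by (simp add: su_part_def)
  finally show ?thesis by blast
qed

lemma bounded_linear_su_part: "bounded_linear (su_part :: 'n::finite cmat \<Rightarrow> 'n cmat)"
  unfolding linear_conv_bounded_linear [symmetric]
proof (rule linearI)
  fix A B :: "'n cmat" and r :: real
  show "su_part (A + B) = su_part A + su_part B"
    by (simp add: vec_eq_iff su_part_def ctrans_add mtrace_add mtrace_diff mat_def add_divide_distrib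
        diff_divide_distrib algebra_simps)
  show "su_part (r *\<^sub>R A) = r *\<^sub>R su_part A"
    by (simp add: vec_eq_iff su_part_def ctrans_scaleR mtrace_scaleR mtrace_diff mat_def
        diff_divide_distrib scaleR_conv_of_real [where 'a = complex] algebra_simps)
qed

text \<open>To first order \<open>F\<close> moves only along \<open>su\<close>, whereas the open
  mapping theorem is applied on all matrices. The factor \<open>H M\<close> supplies the
  complementary directions, so that \<open>G M = H M ** F M\<close> has the invertible derivative
  \<open>M ** p\<close>. If \<open>G M\<close> lies in \<open>SU\<close>, so does
  \<open>H M\<close>; rigidity near 1 gives \<open>H M = mat 1\<close>, and the point is
  \<open>F M\<close>, an element of the semigroup.\<close>

lemma exp_semigroup_interior:
  fixes WW :: "'n::finite cmat set"
  assumes WW: "WW \<subseteq> su"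
    and gen: "\<And>L. lie_subalgebra L \<Longrightarrow> WW \<subseteq> L \<Longrightarrow> su \<subseteq> L"
  obtains p e where "p \<in> exp_semigroup WW" "e > 0"
    "\<And>X. X \<in> SU \<Longrightarrow> norm (X - p) < e \<Longrightarrow> X \<in> exp_semigroup WW"
proof -
  obtain Ys p where st: "steerable WW Ys p" and ind: "independent Ys" and span: "su \<subseteq> span Ys"
    using steerable_basis_exists [OF WW gen] by blast
  have fin: "finite Ys" using ind by (simp add: independent_imp_finite)
  have p: "p \<in> exp_semigroup WW" using st by (simp add: steerable_def)
  then have pSU: "p \<in> SU" using WW exp_semigroup_SU by blast
  \<comment> \<open>The coordinate functionals of the basis \<open>Ys\<close>, extended linearly to
    all matrices.\<close>
  have "\<exists>g. linear g \<and> (\<forall>x\<in>Ys. g x = (if x = Y then 1 else 0 :: real))" for Y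
    by (rule linear_independent_extend [OF ind])
  then obtain g where g: "\<And>Y. linear (g Y)" "\<And>Y x. x \<in> Ys \<Longrightarrow> g Y x = (if x = Y then 1 else 0 :: real)"
    by metis
  have expand: "(\<Sum>Y\<in>Ys. g Y A *\<^sub>R Y) = A" if "A \<in> su" for A
  proof (rule linear_eq_on [where B = Ys])
    show "linear (\<lambda>A. \<Sum>Y\<in>Ys. g Y A *\<^sub>R Y)"
      by (rule linearI) (simp_all add: g linear_add linear_scale scaleR_add_left sum.distrib scaleR_sum_right)
    show "linear (\<lambda>A. A)" by (rule linear_ident)
    show "A \<in> span Ys" using span that by blast
    show "(\<Sum>Y\<in>Ys. g Y b *\<^sub>R Y) = b" if "b \<in> Ys" for b
    proof -
      have "(\<Sum>Y\<in>Ys. g Y b *\<^sub>R Y) = (\<Sum>Y\<in>Ys. if Y = b then b else 0)"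
        using that g(2) by (intro sum.cong) auto
      then show ?thesis using fin that by simp
    qed
  qed
  \<comment> \<open>With these functionals the derivative of \<open>F\<close> at 0 becomes
    \<open>su_part M ** p\<close>.\<close>
  define s where "s Y M = g Y (su_part M)" for Y M
  have s: "bounded_linear (s Y)" for Y
    unfolding s_def
    by (rule bounded_linear_compose [OF iffD1 [OF linear_conv_bounded_linear g(1)] bounded_linear_su_part])
  obtain F where F: "continuous_on UNIV F" "F 0 = p"
      "(F has_derivative (\<lambda>M. (\<Sum>Y\<in>Ys. s Y M *\<^sub>R Y) ** p)) (at 0)"
      "\<And>M. (\<forall>Y\<in>Ys. \<bar>s Y M\<bar> \<le> 1) \<Longrightarrow> F M \<in> exp_semigroup WW"
    using st s unfolding steerable_def by blast
  have sum_s: "(\<Sum>Y\<in>Ys. s Y M *\<^sub>R Y) = su_part M" for M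
    unfolding s_def by (rule expand [OF su_part_su])
  define H where "H M = mat 1 + (M - su_part M)" for M :: "'n cmat"
  define G where "G M = H M ** F M" for M
  have sp0: "su_part 0 = (0 :: 'n cmat)"
    by (rule linear_0 [OF bounded_linear.linear [OF bounded_linear_su_part]])
  have contH: "continuous_on UNIV H"
    unfolding H_def by (intro continuous_intros bounded_linear.continuous_on [OF bounded_linear_su_part])
  then have contG: "continuous_on UNIV G"
    unfolding G_def by (intro mm.continuous_on F)
  have derG: "(G has_derivative (\<lambda>M. M ** p)) (at 0)"
  proof -
    have "(H has_derivative (\<lambda>M. 0 + (M - su_part M))) (at 0)"
      unfolding H_def
      by (intro has_derivative_add has_derivative_const has_derivative_diff has_derivative_ident
          bounded_linear_imp_has_derivative bounded_linear_su_part)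
    from mm.FDERIV [OF this F(3)] show ?thesis
      unfolding G_def sum_s by (simp add: H_def F(2) sp0 mm.diff_left)
  qed
  obtain \<epsilon> where \<epsilon>: "\<epsilon> > 0" 
    "\<And>(P :: 'n::finite cmat) c. P \<in> SU \<Longrightarrow> P - ctrans P = mat c \<Longrightarrow> norm (P - mat 1) < \<epsilon> \<Longrightarrow> P = mat 1"
    using SU_near_one_rigid by blast
  define T where "T = (\<Inter>Y\<in>Ys. {M. \<bar>s Y M\<bar> < 1}) \<inter> {M. norm (H M - mat 1) < \<epsilon>}"
  have "open T"
    unfolding T_def using fin
    by (intro open_Int open_INT ballI open_Collect_less continuous_intros contH
        bounded_linear.continuous_on [OF s])
  moreover have "0 \<in> T"
    using \<epsilon>(1) by (simp add: T_def H_def sp0 linear_0 [OF bounded_linear.linear [OF s]])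
  ultimately have T: "0 \<in> interior T" by (simp add: interior_open)
  \<comment> \<open>This open mapping theorem asks for continuity, differentiability at the single
    point 0, and a right inverse of the derivative there.\<close>
  have "G 0 \<in> interior (G ` T)"
  proof (rule sussmann_open_mapping [OF open_UNIV contG UNIV_I derG _ _ subset_UNIV T])
    show "bounded_linear (\<lambda>M :: 'n cmat. M ** ctrans p)" by (rule mm.bounded_linear_left)
    show "(\<lambda>M. M ** p) \<circ> (\<lambda>M :: 'n cmat. M ** ctrans p) = id"
      by (simp add: fun_eq_iff SU_cancel_right [OF pSU])
  qed
  moreover have "G 0 = p" by (simp add: G_def H_def sp0 F)
  ultimately obtain e where e: "e > 0" "ball p e \<subseteq> G ` T"
    using mem_interior by metis
  show thesis
  proof
    show "p \<in> exp_semigroup WW" by (rule p)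
    show "e > 0" by (rule e)
    fix X
    assume X: "X \<in> SU" and "norm (X - p) < e"
    then have "X \<in> ball p e" by (simp add: dist_norm norm_minus_commute)
    then obtain M where M: "M \<in> T" "X = G M" using e by blast
    have FM: "F M \<in> exp_semigroup WW" using M(1) by (intro F) (auto simp: T_def intro: less_imp_le)
    then have FSU: "F M \<in> SU" using WW exp_semigroup_SU by blast
    have "H M = X ** ctrans (F M)" by (simp add: M(2) G_def SU_cancel_right [OF FSU])
    then have "H M \<in> SU" using X FSU by (simp add: SU_mult SU_ctrans)
    moreover obtain c where "(M - su_part M) - ctrans (M - su_part M) = mat c"
      using su_part_complement by blast
    then have "H M - ctrans (H M) = mat c" by (simp add: H_def ctrans_add)
    moreover have "norm (H M - mat 1) < \<epsilon>" using M(1) by (simp add: T_def)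
    ultimately have "H M = mat 1" by (rule \<epsilon>)
    then show "X \<in> exp_semigroup WW" using FM by (simp add: M(2) G_def)
  qed
qed

section \<open>Recurrence of powers and subsemigroups with interior\<close>

lemma SU_mpow: "X \<in> SU \<Longrightarrow> mpow X k \<in> SU"
  by (induction k) (auto simp: mpow_Suc intro: SU_mult)

text \<open>By compactness two different powers are close; left multiplication is isometric, so
  their quotient, a positive power of \<open>X\<close>, is close to 1.\<close>

lemma SU_recurrent:
  assumes X: "X \<in> SU" and e: "e > 0"
  obtains m where "norm (mpow X (Suc m) - mat 1) < e"
proof -
  have "seq_compact (SU :: 'a cmat set)" using compact_SU compact_imp_seq_compact by blast
  then obtain l r where r: "strict_mono (r :: nat \<Rightarrow> nat)" "(mpow X \<circ> r) \<longlonglongrightarrow> l"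
    using seq_compactE [of SU "mpow X"] SU_mpow [OF X] by blast
  then have "Cauchy (mpow X \<circ> r)" using LIMSEQ_imp_Cauchy by blast
  from CauchyD [OF this e] obtain k
    where "\<forall>m\<ge>k. \<forall>n\<ge>k. norm ((mpow X \<circ> r) m - (mpow X \<circ> r) n) < e" by blast
  then have k: "norm ((mpow X \<circ> r) (Suc k) - (mpow X \<circ> r) k) < e" by simp
  define m where "m = r (Suc k) - r k - 1"
  have rk: "r (Suc k) = r k + Suc m"
    using strict_monoD [OF r(1), of k "Suc k"] by (simp add: m_def)
  have "mpow X (r (Suc k)) - mpow X (r k) = mpow X (r k) ** (mpow X (Suc m) - mat 1)"
    unfolding rk mpow_add by (simp add: mm.diff_right)
  then have "norm (mpow X (Suc m) - mat 1) < e"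
    using k norm_SU_mult_left [OF SU_mpow [OF X]] by simp
  then show thesis by (rule that)
qed

locale open_subsemigroup =
  fixes R :: "'n::finite cmat set" and e :: real
  assumes R_SU: "R \<subseteq> SU" and mult: "X \<in> R \<Longrightarrow> Y \<in> R \<Longrightarrow> X ** Y \<in> R"
    and e_pos: "e > 0" and near_one: "X \<in> SU \<Longrightarrow> norm (X - mat 1) < e \<Longrightarrow> X \<in> R"
begin

lemma one: "mat 1 \<in> R"
  using near_one e_pos by simp

lemma mpow: "X \<in> R \<Longrightarrow> mpow X k \<in> R"
  by (induction k) (auto simp: mpow_Suc one mult)

text \<open>A positive power of \<open>X\<close> is close to 1, hence so is its inverse, which
  therefore lies in \<open>R\<close>. Multiplying that inverse by one power fewer of
  \<open>X\<close> gives the inverse of \<open>X\<close>.\<close>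

lemma inverse:
  assumes X: "X \<in> R"
  shows "ctrans X \<in> R"
proof -
  have XS: "X \<in> SU" using X R_SU by blast
  obtain m where m: "norm (mpow X (Suc m) - mat 1) < e"
    using SU_recurrent [OF XS e_pos] by blast
  have S: "mpow X (Suc m) \<in> SU" using SU_mpow [OF XS] by blast
  have "norm (ctrans (mpow X (Suc m)) - mat 1) = norm (ctrans (mpow X (Suc m) - mat 1))"
    by (simp add: ctrans_diff)
  then have "ctrans (mpow X (Suc m)) \<in> R"
    using m S by (intro near_one SU_ctrans) simp_all
  then have "mpow X m ** ctrans (mpow X (Suc m)) \<in> R" using mpow [OF X] mult by blast
  moreover have "mpow X m ** ctrans (mpow X (Suc m)) = ctrans X"
    using SU_mpow [OF XS, of m]
    by (simp add: mpow_Suc ctrans_mult matrix_mul_assoc SU_inverse)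
  ultimately show ?thesis by simp
qed

text \<open>A limit point \<open>X\<close> is \<open>Y ** (ctrans Y ** X)\<close> with
  \<open>Y\<close> in \<open>R\<close> near \<open>X\<close>, and the second factor is near 1. So
  \<open>R\<close> is closed in the compact set \<open>SU\<close>.\<close>

lemma compact: "compact R"
proof -
  have "X \<in> R" if cl: "X \<in> closure R" for X
  proof -
    have "closure R \<subseteq> SU" by (rule closure_minimal [OF R_SU compact_imp_closed [OF compact_SU]])
    with cl have X: "X \<in> SU" by blast
    obtain Y where Y: "Y \<in> R" "norm (X - Y) < e"
      using cl e_pos unfolding closure_approachable dist_norm norm_minus_commute [of _ X] by blast
    have YS: "Y \<in> SU" using Y R_SU by blast
    have "ctrans Y ** X - mat 1 = ctrans Y ** (X - Y)"
      by (simp add: mm.diff_right SU_inverse [OF YS])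
    then have "ctrans Y ** X \<in> R"
      using Y(2) norm_SU_mult_left [OF SU_ctrans [OF YS]] X YS
      by (intro near_one SU_mult SU_ctrans) simp_all
    then have "Y ** (ctrans Y ** X) \<in> R" using Y(1) mult by blast
    then show ?thesis by (simp add: SU_cancel_left [OF YS])
  qed
  then have "closed R" by (meson closure_subset_eq subsetI)
  then show ?thesis
    using compact_SU R_SU closed_Int_compact [of R SU] by (simp add: Int_absorb2)
qed

text \<open>For small times of either sign the exponential is in the neighbourhood of 1; other times
  are reached by taking powers.\<close>

lemma mexp_in:
  assumes A: "A \<in> su"
  shows "mexp A t \<in> R"
proof -
  have "isCont (mexp A) 0"
    using continuous_on_mexp [of UNIV A] by (simp add: continuous_on_eq_continuous_at)
  then obtain d where d: "d > 0" "\<And>s. \<bar>s\<bar> < d \<Longrightarrow> norm (mexp A s - mat 1) < e"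
    using e_pos by (auto simp: continuous_at_eps_delta dist_norm)
  obtain k where k: "real (Suc k) > \<bar>t\<bar> / d"
  proof -
    obtain k where "real k > \<bar>t\<bar> / d" using reals_Archimedean2 by blast
    then show thesis using that [of k] by simp
  qed
  define s where "s = t / real (Suc k)"
  have "\<bar>s\<bar> < d" using k d(1) by (simp add: s_def field_simps)
  then have "mexp A s \<in> R" using d(2) mexp_SU [OF A] near_one by blast
  then have "mpow (mexp A s) (Suc k) \<in> R" by (rule mpow)
  moreover have "real (Suc k) * s = t" by (simp add: s_def del: of_nat_Suc)
  ultimately show ?thesis using mexp_mpow [OF A, of "Suc k" s] by simp
qed

end

section \<open>The semigroup is SU(n)\<close>

lemma Emat_nth: "Emat i j $ a $ b = (if a = i \<and> b = j then 1 else 0)"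
  by (simp add: Emat_def)

lemma Bmat_nth: "Bmat i j $ a $ b = (if a = i \<and> b = j then 1 else 0) - (if a = j \<and> b = i then 1 else 0)"
  by (simp add: Bmat_def Emat_nth)

lemma Cmat_nth: "Cmat i j $ a $ b = \<i> * ((if a = i \<and> b = j then 1 else 0) + (if a = j \<and> b = i then 1 else 0))"
  by (simp add: Cmat_def cscale_def Emat_nth)

lemma Dmat_nth: "Dmat i j $ a $ b = \<i> * ((if a = i \<and> b = i then 1 else 0) - (if a = j \<and> b = j then 1 else 0))"
  by (simp add: Dmat_def cscale_def Emat_nth)

lemma Emat_mult_nth:
  fixes V :: "'n::finite cmat"
  shows "(Emat i j ** V) $ a $ b = (if a = i then V $ j $ b else 0)"
    and "(V ** Emat i j) $ a $ b = (if b = j then V $ a $ i else 0)"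
proof -
  have "(Emat i j ** V) $ a $ b = (\<Sum>k\<in>UNIV. if k = j then (if a = i then V $ j $ b else 0) else 0)"
    unfolding matrix_matrix_mult_def vec_lambda_beta by (intro sum.cong) (auto simp: Emat_nth)
  then show "(Emat i j ** V) $ a $ b = (if a = i then V $ j $ b else 0)" by simp
  have "(V ** Emat i j) $ a $ b = (\<Sum>k\<in>UNIV. if k = i then (if b = j then V $ a $ i else 0) else 0)"
    unfolding matrix_matrix_mult_def vec_lambda_beta by (intro sum.cong) (auto simp: Emat_nth)
  then show "(V ** Emat i j) $ a $ b = (if b = j then V $ a $ i else 0)" by simp
qed

lemma cscale_mult:
  "cscale c A ** V = cscale c (A ** V)" "V ** cscale c A = cscale c (V ** A)"
  by (simp_all add: vec_eq_iff cscale_def matrix_matrix_mult_def sum_distrib_left mult_ac)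

lemma cscale_nth: "cscale c A $ a $ b = c * A $ a $ b"
  by (simp add: cscale_def)

lemma Bmat_mult_nth:
  fixes V :: "'n::finite cmat"
  shows "(Bmat i j ** V) $ a $ b = (if a = i then V $ j $ b else 0) - (if a = j then V $ i $ b else 0)"
    and "(V ** Bmat i j) $ a $ b = (if b = j then V $ a $ i else 0) - (if b = i then V $ a $ j else 0)"
  by (simp_all add: Bmat_def mm.diff_left mm.diff_right Emat_mult_nth)

lemma Cmat_mult_nth:
  fixes V :: "'n::finite cmat"
  shows "(Cmat i j ** V) $ a $ b = \<i> * ((if a = i then V $ j $ b else 0) + (if a = j then V $ i $ b else 0))"
    and "(V ** Cmat i j) $ a $ b = \<i> * ((if b = j then V $ a $ i else 0) + (if b = i then V $ a $ j else 0))"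
  by (simp_all add: Cmat_def cscale_mult cscale_nth mm.add_left mm.add_right Emat_mult_nth)

lemma Bmat_su: "i \<noteq> j \<Longrightarrow> Bmat i j \<in> su"
  by (auto simp: su_iff mtrace_def vec_eq_iff Bmat_nth intro!: sum.neutral)

lemma Cmat_su: "i \<noteq> j \<Longrightarrow> Cmat i j \<in> su"
  by (auto simp: su_iff mtrace_def vec_eq_iff Cmat_nth intro!: sum.neutral)

lemma Dmat_su: "Dmat i j \<in> su"
  by (auto simp: su_iff mtrace_def vec_eq_iff Dmat_nth sum_subtractf simp flip: sum_distrib_left)

context open_subsemigroup
begin

text \<open>A diagonal element of \<open>SU\<close> is the exponential of a diagonal element of
  \<open>su\<close>, once its arguments are adjusted to have sum 0.\<close>

lemma diagonal_in:
  assumes V: "V \<in> SU" and diag: "\<And>i j. i \<noteq> j \<Longrightarrow> V $ i $ j = 0"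
  shows "V \<in> R"
proof -
  have norm1: "norm (V $ k $ k) = 1" for k
  proof -
    have "(ctrans V ** V) $ k $ k = (\<Sum>l\<in>UNIV. if l = k then cnj (V $ k $ k) * V $ k $ k else 0)"
      unfolding matrix_matrix_mult_def vec_lambda_beta using diag by (intro sum.cong) auto
    then have "V $ k $ k * cnj (V $ k $ k) = 1"
      using SU_inverse(2) [OF V] by (simp add: mat_nth mult.commute)
    then have "of_real ((norm (V $ k $ k))\<^sup>2) = (1 :: complex)"
      by (simp only: complex_norm_square)
    then have "(norm (V $ k $ k))\<^sup>2 = 1" using of_real_eq_1_iff by blast
    then show ?thesis using norm_ge_zero [of "V $ k $ k"] unfolding power2_eq_1_iff by linarith
  qed
  define \<theta> where "\<theta> k = Arg (V $ k $ k)" for k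
  have V\<theta>: "V $ k $ k = exp (\<i> * of_real (\<theta> k))" for k
    using cis_Arg [of "V $ k $ k"] norm1 [of k]
    by (cases "V $ k $ k = 0") (auto simp: \<theta>_def cis_conv_exp sgn_div_norm)
  define S where "S = (\<Sum>k\<in>UNIV. \<theta> k)"
  have "1 = (\<Prod>k\<in>UNIV. V $ k $ k)"
    using V det_diagonal [of V] diag by (simp add: SU_def)
  also have "\<dots> = exp (\<Sum>k\<in>UNIV. \<i> * of_real (\<theta> k))"
    by (simp add: V\<theta> exp_sum)
  also have "\<dots> = exp (\<i> * of_real S)" by (simp add: S_def sum_distrib_left)
  finally have S: "exp (\<i> * of_real S) = 1" by simp
  \<comment> \<open>An arbitrary index. Since exp(i S) = 1, subtracting the whole sum
    \<open>S\<close> from one angle leaves \<open>V\<close> unchanged and makes the logarithm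
    traceless.\<close>
  define k0 :: 'n where "k0 = undefined"
  define \<theta>' where "\<theta>' k = \<theta> k - (if k = k0 then S else 0)" for k
  have V\<theta>': "V $ k $ k = exp (\<i> * of_real (\<theta>' k))" for k
    by (simp add: \<theta>'_def V\<theta> right_diff_distrib exp_diff S)
  have sum0: "(\<Sum>k\<in>UNIV. \<theta>' k) = 0" by (simp add: \<theta>'_def sum_subtractf S_def)
  define A :: "'n cmat" where "A = (\<chi> i j. if i = j then \<i> * of_real (\<theta>' i) else 0)"
  define X :: "real \<Rightarrow> 'n cmat" where "X t = (\<chi> i j. if i = j then exp (t *\<^sub>R (\<i> * of_real (\<theta>' i))) else 0)" for t
  have A: "A \<in> su"
  proof -
    have "mtrace A = \<i> * of_real (\<Sum>k\<in>UNIV. \<theta>' k)"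
      by (simp add: A_def mtrace_def sum_distrib_left)
    then have "mtrace A = 0" by (simp add: sum0)
    then show ?thesis by (auto simp: su_iff vec_eq_iff A_def)
  qed
  have "(X has_vector_derivative A ** X t) (at t)" for t
  proof (rule has_vector_derivative_cmatI)
    fix i j
    have "(A ** X t) $ i $ j = (\<Sum>k\<in>UNIV. if k = i then \<i> * of_real (\<theta>' i) * X t $ i $ j else 0)"
      unfolding matrix_matrix_mult_def vec_lambda_beta by (intro sum.cong) (auto simp: A_def)
    then have "(A ** X t) $ i $ j = \<i> * of_real (\<theta>' i) * X t $ i $ j" by simp
    then show "((\<lambda>t. X t $ i $ j) has_vector_derivative (A ** X t) $ i $ j) (at t)"
      using exp_scaleR_has_vector_derivative_left [of "\<i> * of_real (\<theta>' i)" t]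
      by (cases "i = j") (simp_all add: X_def)
  qed
  from solution_eq_mexp [OF A this, of 1] have "X 1 = mexp A 1 ** X 0" .
  moreover have "X 0 = mat 1" by (simp add: X_def vec_eq_iff mat_nth)
  moreover have "X 1 = V" using diag by (auto simp: X_def vec_eq_iff V\<theta>')
  ultimately show ?thesis using mexp_in [OF A, of 1] by simp
qed

text \<open>Within the double coset \<open>R U R\<close>, a maximiser of \<open>\<Sum>i. w\<^sub>i Re V\<^sub>i\<^sub>i\<close> with distinct positive weights is diagonal,
  by the first-order conditions in the directions \<open>A V\<close> and \<open>V A\<close>.\<close>

lemma SU_subset: "SU \<subseteq> R"
proof
  fix U :: "'n cmat"
  assume U: "U \<in> SU"
  obtain f :: "'n \<Rightarrow> nat" where f: "inj f"
    using finite_imp_inj_to_nat_seg [of "UNIV :: 'n set"] by auto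
  define w where "w i = 1 + real (f i)" for i
  have w: "w i > 0" "w i = w j \<longleftrightarrow> i = j" for i j
    using f by (auto simp: w_def inj_eq)
  define l where "l X = (\<Sum>i\<in>UNIV. w i * Re (X $ i $ i))" for X :: "'n cmat"
  have l: "bounded_linear l"
    unfolding linear_conv_bounded_linear [symmetric] l_def
    by (rule linearI) (simp_all add: distrib_left sum.distrib sum_distrib_left mult_ac)
  have "\<exists>x\<in>R \<times> R. \<forall>y\<in>R \<times> R. l (fst y ** U ** snd y) \<le> l (fst x ** U ** snd x)"
  proof (rule continuous_attains_sup)
    show "compact (R \<times> R)" by (intro compact_Times compact)
    show "R \<times> R \<noteq> {}" using one by blast
    show "continuous_on (R \<times> R) (\<lambda>x. l (fst x ** U ** snd x))"
      by (intro bounded_linear.continuous_on [OF l] mm.continuous_on continuous_intros)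
  qed
  then obtain g h where gh: "g \<in> R" "h \<in> R"
    and max: "\<And>g' h'. g' \<in> R \<Longrightarrow> h' \<in> R \<Longrightarrow> l (g' ** U ** h') \<le> l (g ** U ** h)"
    by force
  define V where "V = g ** U ** h"
  have ghS: "g \<in> SU" "h \<in> SU" using gh R_SU by auto
  have V: "V \<in> SU" unfolding V_def using ghS U by (intro SU_mult)
  have left: "l (A ** V) = 0" if A: "A \<in> su" for A
  proof -
    have "((\<lambda>t. l (mexp A t ** V)) has_vector_derivative l (mexp A 0 ** 0 + (A ** mexp A 0) ** V)) (at 0)"
      by (intro bounded_linear.has_vector_derivative [OF l] has_vector_derivative_matrix_mult
          mexp_has_vector_derivative has_vector_derivative_const)
    then have "((\<lambda>t. l (mexp A t ** V)) has_real_derivative l (A ** V)) (at 0)"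
      by (simp add: has_real_derivative_iff_has_vector_derivative mm.zero_right)
    moreover have "l (mexp A t ** V) \<le> l (mexp A 0 ** V)" for t
      using max [OF mult [OF mexp_in [OF A, of t] gh(1)] gh(2)]
      by (simp add: V_def matrix_mul_assoc)
    ultimately show ?thesis by (intro DERIV_local_max [where d = 1]) auto
  qed
  have right: "l (V ** A) = 0" if A: "A \<in> su" for A
  proof -
    have "((\<lambda>t. l (V ** mexp A t)) has_vector_derivative l (V ** (A ** mexp A 0) + 0 ** mexp A 0)) (at 0)"
      by (intro bounded_linear.has_vector_derivative [OF l] has_vector_derivative_matrix_mult
          mexp_has_vector_derivative has_vector_derivative_const)
    then have "((\<lambda>t. l (V ** mexp A t)) has_real_derivative l (V ** A)) (at 0)"
      by (simp add: has_real_derivative_iff_has_vector_derivative mm.zero_left)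
    moreover have "l (V ** mexp A t) \<le> l (V ** mexp A 0)" for t
      using max [OF gh(1) mult [OF gh(2) mexp_in [OF A, of t]]]
      by (simp add: V_def matrix_mul_assoc)
    ultimately show ?thesis by (intro DERIV_local_max [where d = 1]) auto
  qed
  have l_if: "(\<Sum>k\<in>UNIV. w k * (if k = i then x k else 0)) = w i * x i" for i x
  proof -
    have "(\<Sum>k\<in>UNIV. w k * (if k = i then x k else 0)) = (\<Sum>k\<in>UNIV. if k = i then w i * x i else 0)"
      by (intro sum.cong) auto
    then show ?thesis by simp
  qed
  have Re_if: "Re (if b then z else 0) = (if b then Re z else 0)"
    and Im_if: "Im (if b then z else 0) = (if b then Im z else 0)" for b z
    by simp_all
  have "V $ i $ j = 0" if ij: "i \<noteq> j" for i j
  proof -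
    \<comment> \<open>The left and right first-order conditions are two equations of this shape.
      Eliminating \<open>x\<close> leaves \<open>(w i - w j) * (w i + w j) * y = 0\<close>, where
      distinctness and positivity of the weights apply.\<close>
    have cancel: "y = 0" if 1: "w i * x = w j * y" and 2: "w j * x = w i * y" for x y
    proof -
      have "(w i - w j) * ((w i + w j) * y) = 0" using 1 2 by algebra
      moreover have "w i + w j > 0" using w(1) [of i] w(1) [of j] by simp
      ultimately show ?thesis using w(2) [of i j] ij by simp
    qed
    have "w i * Re (V $ j $ i) = w j * Re (V $ i $ j)"
      using left [OF Bmat_su [OF ij]]
      by (simp add: l_def Bmat_mult_nth Re_if right_diff_distrib sum_subtractf l_if)
    moreover have "w j * Re (V $ j $ i) = w i * Re (V $ i $ j)"
      using right [OF Bmat_su [OF ij]]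
      by (simp add: l_def Bmat_mult_nth Re_if right_diff_distrib sum_subtractf l_if)
    ultimately have re: "Re (V $ i $ j) = 0" by (rule cancel)
    have "w i * Im (V $ j $ i) = w j * (- Im (V $ i $ j))"
      using left [OF Cmat_su [OF ij]]
      by (simp add: l_def Cmat_mult_nth Im_if distrib_left right_diff_distrib sum_subtractf sum.distrib sum_negf l_if)
    moreover have "w j * Im (V $ j $ i) = w i * (- Im (V $ i $ j))"
      using right [OF Cmat_su [OF ij]]
      by (simp add: l_def Cmat_mult_nth Im_if distrib_left right_diff_distrib sum_subtractf sum.distrib sum_negf l_if)
    ultimately have "- Im (V $ i $ j) = 0" by (rule cancel)
    with re show ?thesis by (simp add: complex_eq_iff)
  qed
  then have "V \<in> R" by (intro diagonal_in V) auto
  then have "ctrans g ** V ** ctrans h \<in> R" by (intro mult inverse gh)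
  moreover have "ctrans g ** V ** ctrans h = U"
    by (simp add: V_def matrix_mul_assoc SU_inverse [OF ghS(1)] SU_cancel_right [OF ghS(2)])
  ultimately show "U \<in> R" by simp
qed

end

text \<open>The interior point \<open>p\<close> is moved to 1 by multiplying with its power
  \<open>?q\<close>, chosen so that \<open>?q ** p\<close> is near 1: if \<open>X\<close> is near 1,
  then \<open>ctrans ?q ** X\<close> is near \<open>p\<close>. The radius \<open>e / 2\<close>
  absorbs the error of the return.\<close>

lemma exp_semigroup_eq_SU:
  fixes WW :: "'n::finite cmat set"
  assumes WW: "WW \<subseteq> su"
    and gen: "\<And>L. lie_subalgebra L \<Longrightarrow> WW \<subseteq> L \<Longrightarrow> su \<subseteq> L"
  shows "exp_semigroup WW = SU"
proof -
  obtain p e where p: "p \<in> exp_semigroup WW" and e: "e > 0"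
    and near: "\<And>X. X \<in> SU \<Longrightarrow> norm (X - p) < e \<Longrightarrow> X \<in> exp_semigroup WW"
    using exp_semigroup_interior [OF WW gen] by blast
  have pS: "p \<in> SU" using p WW exp_semigroup_SU by blast
  obtain m where m: "norm (mpow p (Suc m) - mat 1) < e / 2"
    using SU_recurrent [OF pS, of "e / 2"] e by auto
  interpret open_subsemigroup "exp_semigroup WW" "e / 2"
  proof
    show "exp_semigroup WW \<subseteq> SU" using WW exp_semigroup_SU by blast
    show "e / 2 > 0" using e by simp
    fix X :: "'n cmat"
    assume X: "X \<in> SU" "norm (X - mat 1) < e / 2"
    let ?q = "mpow p m"
    have q: "?q \<in> SU" by (rule SU_mpow [OF pS])
    have "norm (ctrans ?q ** X - p) = norm (?q ** (ctrans ?q ** X - p))"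
      by (simp only: norm_SU_mult_left [OF q])
    also have "?q ** (ctrans ?q ** X - p) = (X - mat 1) - (mpow p (Suc m) - mat 1)"
      using mpow_add [of p m 1]
      by (simp add: mm.diff_right SU_cancel_left [OF q] mpow_Suc)
    finally have "norm (ctrans ?q ** X - p) < e"
      using m X(2) norm_triangle_ineq4 [of "X - mat 1" "mpow p (Suc m) - mat 1"] by linarith
    then have "ctrans ?q ** X \<in> exp_semigroup WW"
      using X(1) q by (intro near SU_mult SU_ctrans)
    then have "?q ** (ctrans ?q ** X) \<in> exp_semigroup WW"
      by (rule exp_semigroup_mult [OF mpow_in_exp_semigroup [OF p]])
    then show "X \<in> exp_semigroup WW" by (simp add: SU_cancel_left [OF q])
  qed (rule exp_semigroup_mult)
  show ?thesis using SU_subset R_SU by blast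
qed

section \<open>Lie subalgebras of su(n)\<close>

text \<open>Counting B as even and C as odd, brackets along adjacent pairs add parities up to sign.
  This is the algebraic counterpart of counting Red edges along a walk.\<close>

lemma bracket_triples:
  assumes "i \<noteq> j" "j \<noteq> k" "i \<noteq> k"
  shows "bracket (Bmat i j) (Bmat j k) = Bmat i k"
    and "bracket (Bmat i j) (Cmat j k) = Cmat i k"
    and "bracket (Cmat i j) (Bmat j k) = Cmat i k"
    and "bracket (Cmat i j) (Cmat j k) = - Bmat i k"
  using assms
  by (auto simp: vec_eq_iff bracket_def Bmat_mult_nth Cmat_mult_nth Bmat_nth Cmat_nth)

lemma bracket_Bmat_Cmat: "i \<noteq> j \<Longrightarrow> bracket (Bmat i j) (Cmat i j) = 2 *\<^sub>R Dmat i j"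
  by (auto simp: vec_eq_iff bracket_def Bmat_mult_nth Bmat_nth Cmat_nth Dmat_nth scaleR_conv_of_real [where 'a = complex])

lemma Bmat_commute: "Bmat j i = - Bmat i j"
  by (auto simp: vec_eq_iff Bmat_nth)

lemma Cmat_commute: "Cmat j i = Cmat i j"
  by (auto simp: vec_eq_iff Cmat_nth)

text \<open>The polynomial \<open>x\<^sup>3 + x\<close> in \<open>ad X\<close>, \<open>X\<close> being \<open>B\<^sub>a\<^sub>b\<close> or \<open>C\<^sub>a\<^sub>b\<close>, annihilates everything outside the
  eigenvalues \<open>\<plusminus>2\<i>\<close> of \<open>ad X\<close>; the corresponding eigenspace is the plane of traceless
  \<open>2 \<times> 2\<close> blocks orthogonal to \<open>X\<close>.\<close>

lemma ad_cubed_plus_ad: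
  fixes X Z :: "'a::finite cmat"
  assumes "X ** X ** X = - X"
  shows "bracket X (bracket X (bracket X Z)) + bracket X Z = 3 *\<^sub>R (X ** Z ** (X ** X) - X ** X ** Z ** X)"
proof -
  have thrice: "3 *\<^sub>R A = A + A + A" for A :: "'a cmat"
    by (simp add: vec_eq_iff complex_eq_iff)
  have eq: "X ** (X ** X) = - X" using assms by (simp add: matrix_mul_assoc)
  have "bracket X (bracket X (bracket X Z)) = X ** X ** X ** Z - 3 *\<^sub>R (X ** X ** Z ** X)
      + 3 *\<^sub>R (X ** Z ** (X ** X)) - Z ** (X ** (X ** X))"
    unfolding thrice bracket_def
    by (simp only: mm.diff_left mm.diff_right matrix_mul_assoc) (simp add: algebra_simps)
  then show ?thesis
    unfolding assms eq by (simp add: bracket_def mm.minus_left mm.minus_right scaleR_diff_right)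
qed

lemma Bmat_squared: "a \<noteq> b \<Longrightarrow> Bmat a b ** Bmat a b = - Emat a a - Emat b b"
  and Cmat_squared: "a \<noteq> b \<Longrightarrow> Cmat a b ** Cmat a b = - Emat a a - Emat b b"
  by (auto simp: vec_eq_iff Bmat_mult_nth Cmat_mult_nth Bmat_nth Cmat_nth Emat_nth)

lemma Bmat_cubed: "a \<noteq> b \<Longrightarrow> Bmat a b ** Bmat a b ** Bmat a b = - Bmat a b"
  and Cmat_cubed: "a \<noteq> b \<Longrightarrow> Cmat a b ** Cmat a b ** Cmat a b = - Cmat a b"
  unfolding Bmat_squared Cmat_squared
  by (auto simp: vec_eq_iff mm.minus_left mm.diff_left Emat_mult_nth Bmat_nth Cmat_nth)

lemma lie_subalgebraD:
  assumes "lie_subalgebra L"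
  shows "A \<in> L \<Longrightarrow> B \<in> L \<Longrightarrow> bracket A B \<in> L" "A \<in> L \<Longrightarrow> B \<in> L \<Longrightarrow> A + B \<in> L"
    "A \<in> L \<Longrightarrow> B \<in> L \<Longrightarrow> A - B \<in> L" "A \<in> L \<Longrightarrow> r *\<^sub>R A \<in> L" "A \<in> L \<Longrightarrow> - A \<in> L" "subspace L"
  using assms by (auto simp: lie_subalgebra_def subspace_add subspace_diff subspace_scale subspace_neg)

lemma su_nth:
  assumes "Z \<in> su"
  shows "Z $ b $ a = - cnj (Z $ a $ b)" "Re (Z $ a $ a) = 0"
proof -
  have "ctrans Z = - Z" using assms by (simp add: su_iff)
  then have *: "cnj (Z $ a $ b) = - Z $ b $ a" for a b
    by (simp add: vec_eq_iff)
  then show "Z $ b $ a = - cnj (Z $ a $ b)" by simp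
  show "Re (Z $ a $ a) = 0" using arg_cong [OF * [of a a], of Re] by simp
qed

text \<open>Applying x^3 + x in ad B_ab to \<open>Z\<close> leaves only a combination
  \<open>T\<close> of C_ab and D_ab. A further ad B_ab acts on this plane as twice a quarter turn,
  so a combination of \<open>T\<close> and its image isolates C_ab.\<close>

lemma Cmat_in_lie_subalgebra:
  assumes L: "lie_subalgebra L" and ab: "a \<noteq> b" and B: "Bmat a b \<in> L"
    and Z: "Z \<in> L" "Z \<in> su" and nz: "Im (Z $ a $ b) \<noteq> 0 \<or> Z $ a $ a \<noteq> Z $ b $ b"
  shows "Cmat a b \<in> L"
proof -
  define y where "y = Im (Z $ a $ b)"
  define \<delta> where "\<delta> = Im (Z $ a $ a) - Im (Z $ b $ b)"
  note su = su_nth(1) [OF Z(2), of a b] su_nth(2) [OF Z(2)]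
  define T where "T = bracket (Bmat a b) (bracket (Bmat a b) (bracket (Bmat a b) Z)) + bracket (Bmat a b) Z"
  have T_L: "T \<in> L" unfolding T_def by (intro lie_subalgebraD [OF L] B Z)
  have T: "T = (3 * \<delta>) *\<^sub>R Cmat a b - (6 * y) *\<^sub>R Dmat a b"
    unfolding T_def ad_cubed_plus_ad [OF Bmat_cubed [OF ab]] unfolding Bmat_squared [OF ab]
    using ab su
    by (auto simp: vec_eq_iff mm.minus_left mm.minus_right mm.diff_left mm.diff_right Emat_mult_nth
        Bmat_mult_nth Cmat_nth Dmat_nth y_def \<delta>_def complex_eq_iff)
  have S: "bracket (Bmat a b) T = (12 * y) *\<^sub>R Cmat a b + (6 * \<delta>) *\<^sub>R Dmat a b"
    unfolding T using ab
    by (auto simp: vec_eq_iff bracket_def Bmat_mult_nth Cmat_nth Dmat_nth complex_eq_iff)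
  \<comment> \<open>A sum of squares that vanishes only if both the diagonal difference and the
    imaginary off-diagonal part of \<open>Z\<close> do.\<close>
  define c where "c = 3 * (\<delta> * \<delta> + 4 * (y * y))"
  have "\<delta> *\<^sub>R T + y *\<^sub>R bracket (Bmat a b) T = c *\<^sub>R Cmat a b"
    unfolding S unfolding T c_def by (simp add: algebra_simps)
  moreover have "\<delta> *\<^sub>R T + y *\<^sub>R bracket (Bmat a b) T \<in> L"
    by (intro lie_subalgebraD [OF L] B T_L)
  ultimately have "c *\<^sub>R Cmat a b \<in> L" by simp
  then have "(1 / c) *\<^sub>R (c *\<^sub>R Cmat a b) \<in> L" by (rule lie_subalgebraD [OF L])
  moreover have "c \<noteq> 0"
  proof -
    have "\<delta> \<noteq> 0 \<or> y \<noteq> 0" using nz su by (auto simp: y_def \<delta>_def complex_eq_iff)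
    then show ?thesis
      unfolding c_def using sum_squares_eq_zero_iff [of \<delta> "2 * y"] by (auto simp: algebra_simps)
  qed
  ultimately show ?thesis by simp
qed

text \<open>The same filter with B and C exchanged: ad C_ab acts on the plane of B_ab and D_ab, and
  the real part of the entry is what counts.\<close>

lemma Bmat_in_lie_subalgebra:
  assumes L: "lie_subalgebra L" and ab: "a \<noteq> b" and C: "Cmat a b \<in> L"
    and Z: "Z \<in> L" "Z \<in> su" and nz: "Re (Z $ a $ b) \<noteq> 0 \<or> Z $ a $ a \<noteq> Z $ b $ b"
  shows "Bmat a b \<in> L"
proof -
  define x where "x = Re (Z $ a $ b)"
  define \<delta> where "\<delta> = Im (Z $ a $ a) - Im (Z $ b $ b)"
  note su = su_nth(1) [OF Z(2), of a b] su_nth(2) [OF Z(2)]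
  define T where "T = bracket (Cmat a b) (bracket (Cmat a b) (bracket (Cmat a b) Z)) + bracket (Cmat a b) Z"
  have T_L: "T \<in> L" unfolding T_def by (intro lie_subalgebraD [OF L] C Z)
  have T: "T = (6 * x) *\<^sub>R Dmat a b - (3 * \<delta>) *\<^sub>R Bmat a b"
    unfolding T_def ad_cubed_plus_ad [OF Cmat_cubed [OF ab]] unfolding Cmat_squared [OF ab]
    using ab su
    by (auto simp: vec_eq_iff mm.minus_left mm.minus_right mm.diff_left mm.diff_right Emat_mult_nth
        Cmat_mult_nth Bmat_nth Dmat_nth x_def \<delta>_def complex_eq_iff)
  have S: "bracket (Cmat a b) T = (12 * x) *\<^sub>R Bmat a b + (6 * \<delta>) *\<^sub>R Dmat a b"
    unfolding T using ab
    by (auto simp: vec_eq_iff bracket_def Cmat_mult_nth Bmat_nth Dmat_nth complex_eq_iff)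
  define c where "c = 3 * (\<delta> * \<delta> + 4 * (x * x))"
  have "x *\<^sub>R bracket (Cmat a b) T - \<delta> *\<^sub>R T = c *\<^sub>R Bmat a b"
    unfolding S unfolding T c_def by (simp add: algebra_simps)
  moreover have "x *\<^sub>R bracket (Cmat a b) T - \<delta> *\<^sub>R T \<in> L"
    by (intro lie_subalgebraD [OF L] C T_L)
  ultimately have "c *\<^sub>R Bmat a b \<in> L" by simp
  then have "(1 / c) *\<^sub>R (c *\<^sub>R Bmat a b) \<in> L" by (rule lie_subalgebraD [OF L])
  moreover have "c \<noteq> 0"
  proof -
    have "\<delta> \<noteq> 0 \<or> x \<noteq> 0" using nz su by (auto simp: x_def \<delta>_def complex_eq_iff)
    then show ?thesis
      unfolding c_def using sum_squares_eq_zero_iff [of \<delta> "2 * x"] by (auto simp: algebra_simps)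
  qed
  ultimately show ?thesis by simp
qed

text \<open>The diagonal is expanded against one reference index \<open>k\<close>, where the surplus
  is the trace and vanishes. The factor 1/2 is due to summing over ordered pairs.\<close>

lemma su_expansion:
  fixes A :: "'n::finite cmat"
  assumes A: "A \<in> su"
  shows "A = (\<Sum>i\<in>UNIV. Im (A $ i $ i) *\<^sub>R Dmat i k) +
    (\<Sum>i\<in>UNIV. \<Sum>j\<in>UNIV. if i = j then 0 else (1 / 2) *\<^sub>R (Re (A $ i $ j) *\<^sub>R Bmat i j + Im (A $ i $ j) *\<^sub>R Cmat i j))"
    (is "A = ?D + ?O")
proof -
  have "A $ a $ b = (?D + ?O) $ a $ b" for a b
  proof -
    have "(\<Sum>i\<in>UNIV. A $ i $ i) = 0" using A by (simp add: su_iff mtrace_def)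
    then have tr: "(\<Sum>i\<in>UNIV. Im (A $ i $ i)) = 0" using Im_sum [of "\<lambda>i. A $ i $ i" UNIV] by simp
    have "?D $ a $ b = (\<Sum>i\<in>UNIV. if i = a then (if a = b then \<i> * Im (A $ a $ a) else 0) else 0)
        - (\<Sum>i\<in>UNIV. Im (A $ i $ i)) *\<^sub>R (if a = k \<and> b = k then \<i> else 0)"
      unfolding scaleR_sum_left sum_subtractf [symmetric] sum_component
      by (intro sum.cong) (auto simp: Dmat_nth scaleR_conv_of_real [where 'a = complex] algebra_simps)
    then have D: "?D $ a $ b = (if a = b then \<i> * Im (A $ a $ a) else 0)"
      using tr by simp
    define x where "x i j = (1 / 2) *\<^sub>R A $ i $ j" for i j
    have "?O $ a $ b = (\<Sum>i\<in>UNIV. \<Sum>j\<in>UNIV.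
          (if i = a then if j = b then (if a = b then 0 else x a b) else 0 else 0) +
          (if i = b then if j = a then (if a = b then 0 else - cnj (x b a)) else 0 else 0))"
      unfolding sum_component
      by (intro sum.cong) (auto simp: Bmat_nth Cmat_nth x_def complex_eq_iff)
    also have "\<dots> = (if a = b then 0 else x a b - cnj (x b a))"
    proof -
      have inner: "(\<Sum>j\<in>(UNIV::'n set). if i = u then if j = v then z else 0 else 0) = (if i = u then z else 0)"
        for i u v :: 'n and z :: complex by (cases "i = u") simp_all
      have "(\<Sum>i\<in>UNIV. \<Sum>j\<in>UNIV. if i = u then if j = v then z else 0 else 0) = z"
        for u v :: 'n and z :: complex unfolding inner by simp
      then show ?thesis unfolding sum.distrib by simp
    qed
    also have "\<dots> = (if a = b then 0 else A $ a $ b)"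
      using su_nth(1) [OF A, of a b] by (simp add: x_def complex_eq_iff)
    finally show ?thesis
      using D su_nth(2) [OF A, of a] by (auto simp: complex_eq_iff)
  qed
  then show ?thesis unfolding vec_eq_iff by blast
qed

section \<open>Walks, parity and generated Lie algebras\<close>

text \<open>The Boolean records whether a walk between the two nodes has an odd number of Red edges;
  \<open>\<noteq>\<close> on Booleans is addition of parities.\<close>

inductive linked :: "'n cedge set \<Rightarrow> 'n \<Rightarrow> 'n \<Rightarrow> bool \<Rightarrow> bool" for E where
  refl: "linked E i i False"
| step: "e \<in> E \<Longrightarrow> fst e = {i, j} \<Longrightarrow> linked E j k p \<Longrightarrow> linked E i k (p \<noteq> (snd e = Red))"

lemma walk_Cons:
  "walk E (v # vs) (e # es) \<longleftrightarrow> e \<in> E \<and> fst e = {v, hd vs} \<and> walk E vs es"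
proof (cases vs)
  case Nil
  then show ?thesis by (simp add: walk_def)
next
  case (Cons w ws)
  then show ?thesis by (auto simp: walk_def All_less_Suc2)
qed

lemma walk_imp_linked:
  "walk E vs es \<Longrightarrow> linked E (hd vs) (last vs) (odd (red_count es))"
proof (induction es arbitrary: vs)
  case Nil
  then obtain v where "vs = [v]" by (auto simp: walk_def length_Suc_conv)
  then show ?case by (simp add: red_count_def linked.refl)
next
  case (Cons e es)
  then obtain v ws where vs: "vs = v # ws" by (cases vs) (auto simp: walk_def)
  then have w: "e \<in> E" "fst e = {v, hd ws}" "walk E ws es" using Cons.prems unfolding vs walk_Cons by auto
  from w(3) have "ws \<noteq> []" by (auto simp: walk_def)
  then show ?case
    using linked.step [OF w(1,2) Cons.IH [OF w(3)]] by (auto simp: vs red_count_def)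
qed

lemma linked_imp_walk:
  "linked E i j p \<Longrightarrow> \<exists>vs es. walk E vs es \<and> hd vs = i \<and> last vs = j \<and> odd (red_count es) = p"
proof (induction rule: linked.induct)
  case (refl i)
  show ?case
    by (intro exI [of _ "[i]"] exI [of _ "[]"]) (simp add: walk_def red_count_def)
next
  case (step e i j k p)
  then obtain vs es where w: "walk E vs es" "hd vs = j" "last vs = k" "odd (red_count es) = p" by blast
  moreover have "vs \<noteq> []" using w(1) by (auto simp: walk_def)
  ultimately show ?case
    using step.hyps
    by (intro exI [of _ "i # vs"] exI [of _ "e # es"]) (auto simp: walk_Cons red_count_def)
qed

lemma linked_trans: "linked E i j p \<Longrightarrow> linked E j k q \<Longrightarrow> linked E i k (p \<noteq> q)"
proof (induction rule: linked.induct)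
  case (step e i j l p)
  then have "linked E i k ((p \<noteq> q) \<noteq> (snd e = Red))"
    by (intro linked.step [of e]) auto
  moreover have "((p \<noteq> q) \<noteq> (snd e = Red)) = ((p \<noteq> (snd e = Red)) \<noteq> q)" by blast
  ultimately show ?case by (simp only:)
qed simp

lemma linked_edge: "e \<in> E \<Longrightarrow> fst e = {i, j} \<Longrightarrow> linked E i j (snd e = Red)"
  using linked.step [OF _ _ linked.refl, of e E i j] by simp

lemma linked_sym: "linked E i j p \<Longrightarrow> linked E j i p"
proof (induction rule: linked.induct)
  case (step e i j k p)
  then have "linked E j i (snd e = Red)"
    by (intro linked_edge) auto
  then show ?case using linked_trans [OF step.IH] by blast
qed (rule linked.refl)

lemma linked_mono: "linked E i j p \<Longrightarrow> E \<subseteq> E' \<Longrightarrow> linked E' i j p"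
proof (induction rule: linked.induct)
  case (step e i j k p)
  then show ?case by (intro linked.step [of e]) auto
qed (rule linked.refl)

lemma connected_mg_linked: "connected_mg E \<Longrightarrow> \<exists>p. linked E i j p"
proof -
  assume "connected_mg E"
  then obtain vs es where "walk E vs es" "hd vs = i" "last vs = j"
    unfolding connected_mg_def by blast
  then show ?thesis using walk_imp_linked [of E vs es] by auto
qed

lemma odd_cycle_iff_linked: "(\<exists>vs es. cycle E vs es \<and> odd (red_count es)) \<longleftrightarrow> (\<exists>i. linked E i i True)"
proof
  assume "\<exists>vs es. cycle E vs es \<and> odd (red_count es)"
  then obtain vs es where "walk E vs es" "hd vs = last vs" "odd (red_count es)"
    by (auto simp: cycle_def)
  then show "\<exists>i. linked E i i True" using walk_imp_linked [of E vs es] by auto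
next
  assume "\<exists>i. linked E i i True"
  then show "\<exists>vs es. cycle E vs es \<and> odd (red_count es)"
    using linked_imp_walk [of E _ _ True] by (fastforce simp: cycle_def)
qed

section \<open>Generators attached to edges and their propagation by brackets\<close>

definition edge_gen :: "bool \<Rightarrow> 'n::finite \<Rightarrow> 'n \<Rightarrow> 'n cmat" where
  "edge_gen red i j = (if red then Cmat i j else Bmat i j)"

lemma edge_gen_sym:
  assumes L: "lie_subalgebra L" and "edge_gen p i j \<in> L"
  shows "edge_gen p j i \<in> L"
  using assms lie_subalgebraD(5) [OF L, of "Bmat i j"]
  by (auto simp: edge_gen_def Cmat_commute [of j i] Bmat_commute [of j i])

lemma edge_gen_trans:
  assumes L: "lie_subalgebra L" and ne: "i \<noteq> j" "j \<noteq> k" "i \<noteq> k"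
    and p: "edge_gen p i j \<in> L" and q: "edge_gen q j k \<in> L"
  shows "edge_gen (p \<noteq> q) i k \<in> L"
  using lie_subalgebraD(1) [OF L p q] lie_subalgebraD(5) [OF L, of "- Bmat i k"]
  by (auto simp: edge_gen_def bracket_triples [OF ne] split: if_splits)

definition full_at :: "'n::finite cmat set \<Rightarrow> 'n \<Rightarrow> 'n \<Rightarrow> bool" where
  "full_at L i j \<longleftrightarrow> i \<noteq> j \<and> (\<forall>p. edge_gen p i j \<in> L)"

text \<open>Bracketing with one fixed generator at \<open>j\<close>, \<open>k\<close> permutes the
  two parities, so having both at \<open>i\<close>, \<open>j\<close> gives both at \<open>i\<close>,
  \<open>k\<close>.\<close>

lemma full_at_extend:
  assumes L: "lie_subalgebra L" and f: "full_at L i j" and "j \<noteq> k" "i \<noteq> k" and q: "edge_gen q j k \<in> L"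
  shows "full_at L i k"
  unfolding full_at_def
proof (intro conjI allI)
  fix p
  have "edge_gen (p \<noteq> q) i j \<in> L" "i \<noteq> j" using f by (auto simp: full_at_def)
  then have "edge_gen ((p \<noteq> q) \<noteq> q) i k \<in> L"
    using assms by (intro edge_gen_trans [OF L, of i j k]) auto
  then show "edge_gen p i k \<in> L" by (cases p; cases q) simp_all
qed (use assms in simp)

text \<open>Fullness spreads from the pair \<open>a\<close>, \<open>b\<close> to all pairs
  containing \<open>a\<close> and from there to every pair. Brackets of B and C then give the
  diagonal generators.\<close>

lemma full_at_imp_su:
  fixes L :: "'n::finite cmat set"
  assumes L: "lie_subalgebra L" and conn: "\<And>i j. i \<noteq> j \<Longrightarrow> \<exists>p. edge_gen p i j \<in> L"
    and f: "full_at L a b"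
  shows "su \<subseteq> L"
proof -
  have sym: "full_at L j i" if "full_at L i j" for i j
    using that edge_gen_sym [OF L] by (auto simp: full_at_def)
  have a: "full_at L a j" if "j \<noteq> a" for j
  proof (cases "j = b")
    case False
    then obtain q where "edge_gen q b j \<in> L" using conn [of b j] by auto
    then show ?thesis using full_at_extend [OF L f _ _, of j q] False that by blast
  qed (use f in simp)
  have full: "full_at L i j" if "i \<noteq> j" for i j
  proof (cases "i = a \<or> j = a")
    case True
    then show ?thesis using a [of i] a [of j] sym [of j i] that by auto
  next
    case False
    then obtain q where "edge_gen q a j \<in> L" using conn [of a j] by auto
    then show ?thesis using full_at_extend [OF L sym [OF a [of i]], of j q] False that by blast
  qed
  then have BC: "Bmat i j \<in> L" "Cmat i j \<in> L" if "i \<noteq> j" for i j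
    using full [OF that] by (auto simp: full_at_def edge_gen_def all_bool_eq)
  have D: "Dmat i j \<in> L" for i j
  proof (cases "i = j")
    case True
    then have "Dmat i j = 0" by (simp add: vec_eq_iff Dmat_nth)
    then show ?thesis using L by (simp add: lie_subalgebra_def subspace_0)
  next
    case False
    then have "(1 / 2) *\<^sub>R bracket (Bmat i j) (Cmat i j) \<in> L"
      by (intro lie_subalgebraD [OF L] BC)
    then show ?thesis using False by (simp add: bracket_Bmat_Cmat)
  qed
  show ?thesis
  proof
    fix A :: "'n cmat"
    assume "A \<in> su"
    from su_expansion [OF this, of a] show "A \<in> L"
      by (rule ssubst)
        (use BC D in \<open>auto intro!: lie_subalgebraD [OF L] subspace_sum [OF lie_subalgebraD(6) [OF L]]
          simp: subspace_0 [OF lie_subalgebraD(6) [OF L]]\<close>)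
  qed
qed

text \<open>The off-diagonal component tested is that of the colour not yet present at the pair; a
  diagonal difference serves for either colour.\<close>

lemma edge_gen_complete:
  assumes L: "lie_subalgebra L" and ij: "i \<noteq> j" and p: "edge_gen p i j \<in> L" and Z: "Z \<in> L" "Z \<in> su"
    and nz: "(if p then Re (Z $ i $ j) else Im (Z $ i $ j)) \<noteq> 0 \<or> Z $ i $ i \<noteq> Z $ j $ j"
  shows "full_at L i j"
  using Cmat_in_lie_subalgebra [OF L ij _ Z] Bmat_in_lie_subalgebra [OF L ij _ Z] p nz ij
  by (cases p) (auto simp: full_at_def edge_gen_def)

section \<open>Choice of a drift that completes the control algebra\<close>

definition ctrl :: "('n::finite \<times> 'n) set \<Rightarrow> ('n \<times> 'n) set \<Rightarrow> ('n \<times> 'n) set \<Rightarrow> 'n cmat set" where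
  "ctrl S1 S2 S3 = (\<lambda>(i, j). Bmat i j) ` S1 \<union> (\<lambda>(i, j). Cmat i j) ` S2 \<union> (\<lambda>(i, j). Dmat i j) ` S3"

text \<open>With all coefficients nonzero the contributions may cancel. Two candidates suffice: all
  coefficients 1, or 2 at \<open>A\<close> and 1 elsewhere. Their values under \<open>\<phi>\<close>
  differ by \<open>\<phi> A\<close>, so they are not both 0.\<close>

lemma Sigma_r_avoiding:
  fixes As :: "'n::finite cmat set"
  assumes fin: "finite As" and \<phi>: "linear (\<phi> :: 'n cmat \<Rightarrow> real)" and A: "A \<in> As" "\<phi> A \<noteq> 0"
  obtains B where "B \<in> Sigma_r As" "\<phi> B \<noteq> 0"
proof (cases "\<phi> (\<Sum>g\<in>As. 1 *\<^sub>R g) = 0")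
  case False
  moreover have "(\<Sum>g\<in>As. 1 *\<^sub>R g) \<in> Sigma_r As"
    unfolding Sigma_r_def by (auto intro!: exI [of _ "\<lambda>_. 1"])
  ultimately show thesis using that by blast
next
  case True
  define B where "B = (\<Sum>g\<in>As. (if g = A then 2 else 1) *\<^sub>R g)"
  have "B = (\<Sum>g\<in>As. 1 *\<^sub>R g + (if g = A then A else 0))"
    unfolding B_def by (intro sum.cong) (auto simp: scaleR_2)
  also have "\<dots> = (\<Sum>g\<in>As. 1 *\<^sub>R g) + A"
    using fin A(1) by (simp add: sum.distrib)
  finally have "\<phi> B = \<phi> A" using True \<phi> by (simp add: linear_add)
  moreover have "B \<in> Sigma_r As"
    unfolding Sigma_r_def B_def by (auto intro!: exI [of _ "\<lambda>g. if g = A then 2 else 1"] split: if_splits)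
  ultimately show thesis using that [of B] A(2) by simp
qed

lemma Sigma_r_subset_subspace: "subspace V \<Longrightarrow> G \<subseteq> V \<Longrightarrow> Sigma_r G \<subseteq> V"
  unfolding Sigma_r_def by (auto intro!: subspace_sum subspace_scale)

lemma Sigma_f_subset_subspace: "subspace V \<Longrightarrow> G \<subseteq> V \<Longrightarrow> Sigma_f G \<subseteq> V"
  unfolding Sigma_f_def by (auto intro!: subspace_sum subspace_scale)

lemma ctrl_su:
  fixes S1 S2 S3 :: "('n::{finite,linorder} \<times> 'n) set"
  assumes "S1 \<subseteq> {(i, j). i < j}" "S2 \<subseteq> {(i, j). i < j}"
  shows "ctrl S1 S2 S3 \<subseteq> su"
  using assms by (auto simp: ctrl_def Bmat_su Cmat_su Dmat_su)

lemma lie_subalgebra_Inter: "(\<And>L. L \<in> F \<Longrightarrow> lie_subalgebra L) \<Longrightarrow> lie_subalgebra (\<Inter>F)"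
  unfolding lie_subalgebra_def by (auto intro: subspace_Inter)

text \<open>Brackets along a walk of control edges produce a generator at its distinct endpoints.
  Its colour is left open, as the walk may contain self-loops or revisit nodes.\<close>

lemma linked_contr_imp_edge_gen:
  assumes L: "lie_subalgebra L" and c: "ctrl S1 S2 S3 \<subseteq> L" and "linked (G_contr S1 S2 S3) i j p"
  shows "i \<noteq> j \<Longrightarrow> \<exists>q. edge_gen q i j \<in> L"
  using assms(3)
proof (induction rule: linked.induct)
  case (step e i j k p)
  show ?case
  proof (cases "i = j")
    case True
    then show ?thesis using step by blast
  next
    case False
    then have "(\<exists>q. edge_gen q i j \<in> L) \<or> (\<exists>q. edge_gen q j i \<in> L)"
      using step.hyps(1,2) c
      by (force simp: G_contr_def ctrl_def edge_gen_def doubleton_eq_iff ex_bool_eq)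
    then obtain q where q: "edge_gen q i j \<in> L" using edge_gen_sym [OF L] by blast
    show ?thesis
    proof (cases "j = k")
      case True
      then show ?thesis using q by blast
    next
      case jk: False
      then obtain r where "edge_gen r j k \<in> L" using step.IH by blast
      then show ?thesis using edge_gen_trans [OF L False jk step.prems q] by blast
    qed
  qed
qed simp

lemma full_at_mono: "full_at L i j \<Longrightarrow> L \<subseteq> L' \<Longrightarrow> full_at L' i j"
  by (auto simp: full_at_def)

text \<open>If no pair carries both generators, each pair has at most one colour, so the parity of
  every walk is the colour of its endpoints and closed walks are even.\<close>

lemma linked_imp_edge_gen:
  assumes L: "lie_subalgebra L" and nf: "\<And>i j. \<not> full_at L i j"
    and E: "\<And>e i j. e \<in> E \<Longrightarrow> fst e = {i, j} \<Longrightarrow> i \<noteq> j \<and> edge_gen (snd e = Red) i j \<in> L"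
    and "linked E i j p"
  shows "if i = j then \<not> p else edge_gen p i j \<in> L"
  using assms(4)
proof (induction rule: linked.induct)
  case (step e i j k p)
  define r where "r = (snd e = Red)"
  have ij: "i \<noteq> j" and r: "edge_gen r i j \<in> L" using E step.hyps by (auto simp: r_def)
  show ?case
  proof (cases "j = k")
    case True
    then have "p = False" using step.IH by simp
    then show ?thesis using True ij r by (simp add: r_def)
  next
    case jk: False
    then have p: "edge_gen p j k \<in> L" using step.IH by simp
    show ?thesis
    proof (cases "i = k")
      case True
      then have "edge_gen p i j \<in> L" using p edge_gen_sym [OF L] by blast
      \<comment> \<open>The walk returns to \<open>i\<close>, where the bracket rule does not apply.
        Its first edge and the remainder have the same endpoints, so they must have the same
        colour.\<close>
      then have "p = r" using nf [of i j] r ij by (cases p; cases r) (auto simp: full_at_def all_bool_eq)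
      then show ?thesis using True by (simp add: r_def)
    next
      case False
      have "(r \<noteq> p) = (p \<noteq> (snd e = Red))" by (auto simp: r_def)
      then show ?thesis using edge_gen_trans [OF L ij jk False r p] False by (simp only: if_False)
    qed
  qed
qed simp

text \<open>Otherwise every drift matrix has equal diagonal entries, which vanish by tracelessness,
  and off-diagonal parts only of the colour already in \<open>L\<close>. Likewise \<open>S3\<close>
  is empty, as a D would complete its pair. Then every edge agrees with \<open>L\<close>, which
  excludes self-loops and, by \<open>linked_imp_edge_gen\<close>, odd closed walks.\<close>

lemma drift_witness:
  fixes As :: "('n::{finite,linorder}) cmat set"
  assumes As: "As \<subseteq> su"
    and S: "S1 \<subseteq> {(i, j). i < j}" "S2 \<subseteq> {(i, j). i < j}" "S3 \<subseteq> {(i, j). i < j}"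
    and L: "lie_subalgebra L" and c: "ctrl S1 S2 S3 \<subseteq> L"
    and conn: "\<And>i j. i \<noteq> j \<Longrightarrow> \<exists>p. edge_gen p i j \<in> L" and nf: "\<And>i j. \<not> full_at L i j"
    and cond: "has_self_loop (G_drift As \<union> G_contr S1 S2 S3) \<or> linked (G_drift As \<union> G_contr S1 S2 S3) k k True"
  obtains A i j p where "A \<in> As" "i \<noteq> j" "edge_gen p i j \<in> L"
    "(if p then Re (A $ i $ j) else Im (A $ i $ j)) \<noteq> 0 \<or> Im (A $ i $ i) \<noteq> Im (A $ j $ j)"
proof (rule ccontr)
  assume "\<not> thesis"
  with that have none: "(if p then Re (A $ i $ j) else Im (A $ i $ j)) = 0 \<and> Im (A $ i $ i) = Im (A $ j $ j)"
    if "A \<in> As" "i \<noteq> j" "edge_gen p i j \<in> L" for A i j p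
    using that by blast
  have diag: "A $ i $ i = 0" if A: "A \<in> As" for A i
  proof -
    have "A $ j $ j = A $ i $ i" for j
    proof (cases "i = j")
      case False
      then show ?thesis
        using none [OF A False] conn [OF False] su_nth(2) [of A] A As by (auto simp: complex_eq_iff)
    qed simp
    then have "mtrace A = (\<Sum>j\<in>(UNIV :: 'n set). A $ i $ i)"
      unfolding mtrace_def by (intro sum.cong) auto
    moreover have "mtrace A = 0" using A As by (auto simp: su_iff)
    ultimately show ?thesis by simp
  qed
  have S3: "S3 = {}"
  proof (rule equals0I, clarify)
    fix i j
    assume ij: "(i, j) \<in> S3"
    then have ne: "i \<noteq> j" and D: "Dmat i j \<in> L" using S c by (auto simp: ctrl_def)
    obtain p where p: "edge_gen p i j \<in> L" using conn [OF ne] by blast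
    have "full_at L i j"
      by (rule edge_gen_complete [OF L ne p D Dmat_su]) (use ne in \<open>simp add: Dmat_nth\<close>)
    then show False using nf by blast
  qed
  have edge: "i \<noteq> j \<and> edge_gen (snd e = Red) i j \<in> L"
    if e: "e \<in> G_drift As \<union> G_contr S1 S2 S3" and f: "fst e = {i, j}" for e i j
  proof -
    have "\<exists>a b. a \<noteq> b \<and> {i, j} = {a, b} \<and> edge_gen (snd e = Red) a b \<in> L"
      using e
    proof
      assume "e \<in> G_contr S1 S2 S3"
      then consider (blue) a b where "e = ({a, b}, Blue)" "(a, b) \<in> S1"
        | (red) a b where "e = ({a, b}, Red)" "(a, b) \<in> S2"
        unfolding G_contr_def S3 by blast
      then show ?thesis
      proof cases
        case blue
        then have "a \<noteq> b" "Bmat a b \<in> L" using S(1) c by (auto simp: ctrl_def)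
        then show ?thesis using blue f by (intro exI [of _ a] exI [of _ b]) (simp add: edge_gen_def)
      next
        case red
        then have "a \<noteq> b" "Cmat a b \<in> L" using S(2) c by (auto simp: ctrl_def)
        then show ?thesis using red f by (intro exI [of _ a] exI [of _ b]) (simp add: edge_gen_def)
      qed
    next
      assume "e \<in> G_drift As"
      then consider
        (blue) a b A where "e = ({a, b}, Blue)" "a \<noteq> b" "A \<in> As" "Re (A $ a $ b) \<noteq> 0"
        | (red) a b A where "e = ({a, b}, Red)" "a \<noteq> b" "A \<in> As" "Im (A $ a $ b) \<noteq> 0"
        using diag unfolding G_drift_def by blast
      then show ?thesis
      proof cases
        case blue
        obtain p where p: "edge_gen p a b \<in> L" using conn [OF blue(2)] by blast
        then have "\<not> p" using none [OF blue(3,2) p] blue(4) by (cases p) auto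
        then show ?thesis using p blue f by auto
      next
        case red
        obtain p where p: "edge_gen p a b \<in> L" using conn [OF red(2)] by blast
        then have "p" using none [OF red(3,2) p] red(4) by (cases p) auto
        then show ?thesis using p red f by auto
      qed
    qed
    then show ?thesis using edge_gen_sym [OF L] by (auto simp: doubleton_eq_iff)
  qed
  show False
    using cond
  proof
    assume "has_self_loop (G_drift As \<union> G_contr S1 S2 S3)"
    then obtain i c where "({i}, c) \<in> G_drift As \<union> G_contr S1 S2 S3" by (auto simp: has_self_loop_def)
    then show False using edge [of "({i}, c)" i i] by simp
  next
    assume "linked (G_drift As \<union> G_contr S1 S2 S3) k k True"
    from linked_imp_edge_gen [OF L nf edge this] show False by simp
  qed
qed

text \<open>The drift must be fixed before \<open>L\<close> is given. The argument is therefore run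
  in the Lie algebra \<open>L0\<close> generated by the controls, and fullness at a pair is carried
  over to every larger \<open>L\<close> containing \<open>B0\<close>.\<close>

lemma drift_choice:
  fixes As :: "('n::{finite,linorder}) cmat set"
  assumes fin: "finite As" and As: "As \<subseteq> su"
    and S: "S1 \<subseteq> {(i, j). i < j}" "S2 \<subseteq> {(i, j). i < j}" "S3 \<subseteq> {(i, j). i < j}"
    and con: "connected_mg (G_contr S1 S2 S3)"
    and cond: "has_self_loop (G_drift As \<union> G_contr S1 S2 S3) \<or> linked (G_drift As \<union> G_contr S1 S2 S3) k k True"
  obtains B0 where "B0 \<in> Sigma_r As"
    "\<And>L. lie_subalgebra L \<Longrightarrow> ctrl S1 S2 S3 \<subseteq> L \<Longrightarrow> B0 \<in> L \<Longrightarrow> su \<subseteq> L"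
proof -
  define L0 where "L0 = \<Inter>{L. lie_subalgebra L \<and> ctrl S1 S2 S3 \<subseteq> L}"
  have L0: "lie_subalgebra L0" unfolding L0_def by (rule lie_subalgebra_Inter) blast
  have c0: "ctrl S1 S2 S3 \<subseteq> L0" by (auto simp: L0_def)
  have L0_min: "L0 \<subseteq> L" if "lie_subalgebra L" "ctrl S1 S2 S3 \<subseteq> L" for L
    using that by (auto simp: L0_def)
  have conn: "\<exists>p. edge_gen p i j \<in> L" if "lie_subalgebra L" "ctrl S1 S2 S3 \<subseteq> L" "i \<noteq> j" for L i j
    using connected_mg_linked [OF con, of i j] linked_contr_imp_edge_gen [OF that(1,2)] that(3) by blast
  have "\<exists>B0\<in>Sigma_r As. \<exists>a b. \<forall>L. lie_subalgebra L \<and> L0 \<subseteq> L \<and> B0 \<in> L \<longrightarrow> full_at L a b"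
  proof (cases "\<exists>a b. full_at L0 a b")
    case True
    moreover have "(\<Sum>g\<in>As. 1 *\<^sub>R g) \<in> Sigma_r As"
      unfolding Sigma_r_def by (auto intro!: exI [of _ "\<lambda>_. 1"])
    ultimately show ?thesis using full_at_mono by blast
  next
    case False
    then have nf: "\<not> full_at L0 i j" for i j by blast
    obtain A i j p where A: "A \<in> As" and ij: "i \<noteq> j" and p: "edge_gen p i j \<in> L0"
      and nz: "(if p then Re (A $ i $ j) else Im (A $ i $ j)) \<noteq> 0 \<or> Im (A $ i $ i) \<noteq> Im (A $ j $ j)"
      by (rule drift_witness [OF As S L0 c0 conn [OF L0 c0] nf cond])
    \<comment> \<open>A single linear functional detecting the witness: the diagonal difference if
      \<open>A\<close> has one, otherwise the off-diagonal component of the missing colour.\<close>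
    define \<phi> :: "'n cmat \<Rightarrow> real" where "\<phi> Z = (if Im (A $ i $ i) \<noteq> Im (A $ j $ j) then Im (Z $ i $ i) - Im (Z $ j $ j)
        else if p then Re (Z $ i $ j) else Im (Z $ i $ j))" for Z
    have "linear \<phi>" unfolding \<phi>_def by (rule linearI) (simp_all add: algebra_simps)
    moreover have "\<phi> A \<noteq> 0" using nz by (auto simp: \<phi>_def)
    ultimately obtain B0 where B0: "B0 \<in> Sigma_r As" "\<phi> B0 \<noteq> 0"
      by (rule Sigma_r_avoiding [OF fin _ A])
    have "B0 \<in> su" using B0(1) Sigma_r_subset_subspace [OF subspace_su As] by blast
    moreover have "(if p then Re (B0 $ i $ j) else Im (B0 $ i $ j)) \<noteq> 0 \<or> B0 $ i $ i \<noteq> B0 $ j $ j"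
      using B0(2) unfolding \<phi>_def by (auto split: if_splits)
    ultimately have "full_at L i j" if "lie_subalgebra L" "L0 \<subseteq> L" "B0 \<in> L" for L
      using edge_gen_complete [OF that(1) ij _ that(3)] p that(2) by blast
    then show ?thesis using B0(1) by blast
  qed
  then obtain B0 a b where B0: "B0 \<in> Sigma_r As"
      and full: "\<And>L. lie_subalgebra L \<Longrightarrow> L0 \<subseteq> L \<Longrightarrow> B0 \<in> L \<Longrightarrow> full_at L a b" by blast
  show thesis
  proof (rule that [OF B0])
    fix L
    assume L: "lie_subalgebra L" "ctrl S1 S2 S3 \<subseteq> L" "B0 \<in> L"
    show "su \<subseteq> L"
      by (rule full_at_imp_su [OF L(1) conn [OF L(1,2)] full [OF L(1) L0_min [OF L(1,2)] L(3)]])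
  qed
qed

section \<open>Reachability by piecewise constant controls\<close>

lemma reachable_one: "reachable B0 B m (mat 1)"
proof -
  have "piecewise_continuous_on 0 0 (\<lambda>_. 0)"
    unfolding piecewise_continuous_on_def by (intro exI [of _ "{0}"]) auto
  then show ?thesis
    unfolding reachable_def
    by (intro exI [of _ 0] conjI exI [of _ "\<lambda>_ _. 0"] exI [of _ "\<lambda>_. mat 1"] exI [of _ "{}"]) auto
qed

text \<open>The old endpoint \<open>b\<close> is already a breakpoint, so a jump there is harmless
  and only \<open>c\<close> has to be added.\<close>

lemma piecewise_continuous_on_extend:
  assumes f: "piecewise_continuous_on a b f" and bc: "b < c"
  shows "piecewise_continuous_on a c (\<lambda>x. if x \<le> b then f x else k)"
proof -
  obtain P where P: "finite P" "a \<in> P" "b \<in> P" "P \<subseteq> {a..b}"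
    and g: "\<forall>s\<in>P. \<forall>t\<in>P. s < t \<and> {s<..<t} \<inter> P = {} \<longrightarrow>
        (\<exists>g. continuous_on {s..t} g \<and> (\<forall>x\<in>{s<..<t}. g x = f x))"
    using f unfolding piecewise_continuous_on_def by (elim exE conjE)
  show ?thesis
    unfolding piecewise_continuous_on_def
  proof (intro exI [of _ "insert c P"] conjI ballI impI)
    show "insert c P \<subseteq> {a..c}" using P bc by auto
    fix s t
    assume s: "s \<in> insert c P" and t: "t \<in> insert c P" and st: "s < t \<and> {s<..<t} \<inter> insert c P = {}"
    have sP: "s \<in> P" using s t st P bc by force
    show "\<exists>g. continuous_on {s..t} g \<and> (\<forall>x\<in>{s<..<t}. g x = (if x \<le> b then f x else k))"
    proof (cases "t \<in> P")
      case True
      then obtain g' where "continuous_on {s..t} g'" "\<forall>x\<in>{s<..<t}. g' x = f x"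
        using g [rule_format, OF sP True] st by auto
      moreover have "t \<le> b" using True P by auto
      ultimately show ?thesis by (intro exI [of _ g']) auto
    next
      case False
      then have "t = c" using t by simp
      then have "b \<notin> {s<..<c}" using st P(3) by blast
      then have "s \<ge> b" using bc by auto
      then show ?thesis by (intro exI [of _ "\<lambda>_. k"]) auto
    qed
  qed (use P in auto)
qed

text \<open>The control is held constant for a further time \<open>t\<close>. The junction time
  joins the exceptional set, since the trajectory may have a corner there.\<close>

lemma reachable_step:
  assumes Y: "reachable B0 B m Y" and W: "W = B0 + (\<Sum>i\<in>{1..m}. c i *\<^sub>R B i)" and t: "t \<ge> 0"
  shows "reachable B0 B m (mexp W t ** Y)"
proof (cases "t = 0")
  case True
  then show ?thesis using Y by simp
next
  case False
  obtain T u X D where T: "T \<ge> 0"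
    and u: "\<forall>i\<in>{1..m}. piecewise_continuous_on 0 T (u i)"
    and X: "continuous_on {0..T} X" "X 0 = mat 1" "X T = Y"
    and D: "finite D" "\<forall>x\<in>{0<..<T} - D.
        (X has_vector_derivative ((B0 + (\<Sum>i\<in>{1..m}. u i x *\<^sub>R B i)) ** X x)) (at x)"
    using Y unfolding reachable_def by (elim exE conjE)
  define u' where "u' i x = (if x \<le> T then u i x else c i)" for i x
  define X' where "X' x = (if x \<le> T then X x else mexp W (x - T) ** Y)" for x
  have tT: "T < T + t" using False t by simp
  have cont: "continuous_on {0..T + t} X'"
  proof -
    have "continuous_on ({0..T} \<union> {T..T + t}) X'"
      unfolding X'_def
    proof (rule continuous_on_If)
      show "continuous_on {T..T + t} (\<lambda>x. mexp W (x - T) ** Y)"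
        by (intro mm.continuous_on continuous_on_const continuous_on_compose2 [OF continuous_on_mexp [of UNIV W]]
            continuous_intros) auto
    qed (use X in auto)
    moreover have "{0..T} \<union> {T..T + t} = {0..T + t}" using T t by auto
    ultimately show ?thesis by simp
  qed
  have "(X' has_vector_derivative ((B0 + (\<Sum>i\<in>{1..m}. u' i x *\<^sub>R B i)) ** X' x)) (at x)"
    if x: "x \<in> {0<..<T + t} - insert T D" for x
  proof (cases "x < T")
    case True
    then have "(X has_vector_derivative ((B0 + (\<Sum>i\<in>{1..m}. u i x *\<^sub>R B i)) ** X x)) (at x)"
      using x by (intro D(2) [rule_format]) auto
    then have "(X' has_vector_derivative ((B0 + (\<Sum>i\<in>{1..m}. u i x *\<^sub>R B i)) ** X x)) (at x)"
      by (rule has_vector_derivative_transform_within_open [where S = "{..<T}"])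
        (use True in \<open>auto simp: X'_def\<close>)
    then show ?thesis using True by (simp add: u'_def X'_def)
  next
    case F: False
    then have xT: "x > T" using x by auto
    have "((\<lambda>x. mexp W (x - T)) has_vector_derivative W ** mexp W (x - T)) (at x)"
      using vector_diff_chain_at [of "\<lambda>x. x - T" 1 x "mexp W" "W ** mexp W (x - T)"]
      by (simp add: mexp_has_vector_derivative o_def has_vector_derivative_diff_const)
    from has_vector_derivative_matrix_mult [OF this has_vector_derivative_const [of Y]]
    have "((\<lambda>x. mexp W (x - T) ** Y) has_vector_derivative W ** (mexp W (x - T) ** Y)) (at x)"
      by (simp add: mm.zero_right matrix_mul_assoc)
    then have "(X' has_vector_derivative W ** (mexp W (x - T) ** Y)) (at x)"
      by (rule has_vector_derivative_transform_within_open [where S = "{T<..}"])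
        (use xT in \<open>auto simp: X'_def\<close>)
    then show ?thesis using xT by (simp add: u'_def X'_def W)
  qed
  moreover have "piecewise_continuous_on 0 (T + t) (u' i)" if "i \<in> {1..m}" for i
    unfolding u'_def by (rule piecewise_continuous_on_extend [OF u [rule_format, OF that] tT])
  moreover have "X' 0 = mat 1" "X' (T + t) = mexp W t ** Y" using T tT X by (auto simp: X'_def)
  moreover have "finite (insert T D)" "T + t \<ge> 0" using D T t by auto
  ultimately show ?thesis
    unfolding reachable_def using cont
    by (intro exI [of _ "T + t"] exI [of _ u'] exI [of _ X'] exI [of _ "insert T D"] conjI ballI) auto
qed

lemma exp_semigroup_reachable:
  "X \<in> exp_semigroup {B0 + (\<Sum>i\<in>{1..m}. c i *\<^sub>R B i) | c. True} \<Longrightarrow> reachable B0 B m X"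
proof (induction rule: exp_semigroup.induct)
  case (step Z W t)
  then show ?case using reachable_step by blast
qed (rule reachable_one)

section \<open>Necessity\<close>

text \<open>The fixed points of \<open>sharp par\<close> form a conjugate of the algebra of real matrices.\<close>

definition sharp :: "('n \<Rightarrow> bool) \<Rightarrow> 'n::finite cmat \<Rightarrow> 'n cmat" where
  "sharp par X = (\<chi> i j. (if par i = par j then 1 else - 1) * cnj (X $ i $ j))"

lemma sharp_nth: "sharp par X $ i $ j = (if par i = par j then 1 else - 1) * cnj (X $ i $ j)"
  by (simp add: sharp_def)

lemma bounded_linear_sharp: "bounded_linear (sharp par)"
  unfolding linear_conv_bounded_linear [symmetric]
  by (rule linearI) (simp_all add: vec_eq_iff sharp_nth)

text \<open>\<open>sharp par\<close> is entrywise complex conjugation followed by conjugation with a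
  diagonal sign matrix; along an intermediate index the signs multiply.\<close>

lemma sharp_mult: "sharp par (A ** B) = sharp par A ** sharp par B"
proof -
  have "sharp par (A ** B) $ i $ j = (sharp par A ** sharp par B) $ i $ j" for i j
    unfolding matrix_matrix_mult_def sharp_nth vec_lambda_beta cnj_sum sum_distrib_left complex_cnj_mult
    by (intro sum.cong) auto
  then show ?thesis by (simp add: vec_eq_iff)
qed

lemma subspace_sharp_fixed: "subspace {A. sharp par A = A}"
proof -
  have lin: "linear (sharp par)" by (rule bounded_linear.linear [OF bounded_linear_sharp])
  show ?thesis
    by (rule subspaceI) (simp_all add: linear_0 [OF lin] linear_add [OF lin] linear_scale [OF lin])
qed

lemma sharp_Bmat:
  assumes "par i = par j"
  shows "sharp par (Bmat i j) = Bmat i j"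
proof -
  have "sharp par (Bmat i j) $ a $ b = Bmat i j $ a $ b" for a b
  proof (cases "Bmat i j $ a $ b = 0")
    case False
    then have "a = i \<and> b = j \<or> a = j \<and> b = i" by (auto simp: Bmat_nth split: if_splits)
    then have "par a = par b" using assms by auto
    moreover have "cnj (Bmat i j $ a $ b) = Bmat i j $ a $ b"
      unfolding Bmat_nth
      by (simp only: complex_cnj_diff if_distrib [of cnj] complex_cnj_one complex_cnj_zero)
    ultimately show ?thesis by (simp add: sharp_nth)
  qed (simp add: sharp_nth)
  then show ?thesis by (simp add: vec_eq_iff)
qed

lemma sharp_Cmat:
  assumes "par i \<noteq> par j"
  shows "sharp par (Cmat i j) = Cmat i j"
proof -
  have "sharp par (Cmat i j) $ a $ b = Cmat i j $ a $ b" for a b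
  proof (cases "Cmat i j $ a $ b = 0")
    case False
    then have "a = i \<and> b = j \<or> a = j \<and> b = i" by (auto simp: Cmat_nth split: if_splits)
    then have "par a \<noteq> par b" using assms by auto
    moreover have "cnj (Cmat i j $ a $ b) = - Cmat i j $ a $ b"
      unfolding Cmat_nth
      by (simp only: complex_cnj_mult complex_cnj_add complex_cnj_i if_distrib [of cnj]
          complex_cnj_one complex_cnj_zero mult_minus_left)
    ultimately show ?thesis by (simp add: sharp_nth)
  qed (simp add: sharp_nth)
  then show ?thesis by (simp add: vec_eq_iff)
qed

text \<open>The trajectory and its image under \<open>sharp par\<close> solve the same equation with
  the same initial value, so \<open>ctrans (X t) ** sharp par (X t)\<close> stays equal to
  1.\<close>

lemma reachable_sharp_fixed:
  assumes B0: "B0 \<in> su" "sharp par B0 = B0" and B: "\<And>i. i \<in> {1..m} \<Longrightarrow> B i \<in> su \<and> sharp par (B i) = B i"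
    and Y: "reachable B0 B m Y" "Y \<in> SU"
  shows "sharp par Y = Y"
proof -
  obtain T u X D where T: "T \<ge> 0"
    and X: "continuous_on {0..T} X" "X 0 = mat 1" "X T = Y"
    and D: "finite D" "\<forall>x\<in>{0<..<T} - D.
        (X has_vector_derivative ((B0 + (\<Sum>i\<in>{1..m}. u i x *\<^sub>R B i)) ** X x)) (at x)"
    using Y(1) unfolding reachable_def by (elim exE conjE)
  define f where "f t = ctrans (X t) ** sharp par (X t)" for t
  \<comment> \<open>Continuity of \<open>f\<close> bridges the finitely many times at which the
    differential equation may fail.\<close>
  have "f T = mat 1"
  proof (rule has_derivative_zero_unique_strong_interval [where f = f and k = "insert 0 (insert T D)"])
    show "finite (insert 0 (insert T D))" using D by simp
    show "continuous_on {0..T} f"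
      unfolding f_def
      by (intro mm.continuous_on bounded_linear.continuous_on [OF bounded_linear_ctrans]
          bounded_linear.continuous_on [OF bounded_linear_sharp] X)
    have "sharp par (mat 1) = mat 1" by (simp add: vec_eq_iff sharp_nth mat_nth)
    then show "f 0 = mat 1" by (simp add: f_def X)
    show "T \<in> {0..T}" using T by simp
    fix x
    assume x: "x \<in> {0..T} - insert 0 (insert T D)"
    define M where "M = B0 + (\<Sum>i\<in>{1..m}. u i x *\<^sub>R B i)"
    have "M \<in> V" if V: "subspace V" "B0 \<in> V" "\<And>i. i \<in> {1..m} \<Longrightarrow> B i \<in> V" for V
      unfolding M_def by (intro subspace_add [OF V(1)] subspace_sum [OF V(1)] subspace_scale [OF V(1)] V)
    then have M: "M \<in> su" "M \<in> {A. sharp par A = A}"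
      using B0 B subspace_su subspace_sharp_fixed by auto
    have d: "(X has_vector_derivative M ** X x) (at x)" unfolding M_def using x by (intro D(2) [rule_format]) auto
    have "((\<lambda>x. sharp par (X x)) has_vector_derivative sharp par (M ** X x)) (at x)"
      by (rule bounded_linear.has_vector_derivative [OF bounded_linear_sharp d])
    then have "((\<lambda>x. sharp par (X x)) has_vector_derivative M ** sharp par (X x)) (at x)"
      using M(2) by (simp add: sharp_mult)
    then have "(f has_vector_derivative 0) (at x)"
      unfolding f_def using adjoint_solutions_product_constant [OF M(1) d] by simp
    then show "(f has_derivative (\<lambda>h. 0)) (at x within {0..T})"
      by (simp add: has_vector_derivative_def has_derivative_at_withinI)
  qed
  then have "Y ** (ctrans Y ** sharp par Y) = Y" by (simp add: f_def X)
  then show ?thesis by (simp add: SU_cancel_left [OF Y(2)])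
qed

text \<open>On the diagonal the sign is always 1, so for any \<open>par\<close> a diagonal entry
  \<open>\<i>\<close> is conjugated and hence moved.\<close>

lemma sharp_not_identity_on_SU:
  fixes par :: "'n::finite \<Rightarrow> bool"
  assumes "CARD('n) \<ge> 2"
  obtains Y :: "'n cmat" where "Y \<in> SU" "sharp par Y \<noteq> Y"
proof -
  obtain a b :: 'n where ab: "a \<noteq> b"
  proof -
    have "\<exists>b. b \<noteq> (undefined :: 'n)"
    proof (rule ccontr)
      assume "\<not> ?thesis"
      then have "(UNIV :: 'n set) = {undefined}" by blast
      then have "CARD('n) = card {undefined :: 'n}" by (rule arg_cong)
      then show False using assms by simp
    qed
    then show thesis using that by blast
  qed
  define d where "d k = (if k = a then \<i> else if k = b then - \<i> else 1)" for k
  define Y :: "'n cmat" where "Y = (\<chi> i j. if i = j then d i else 0)"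
  have "(ctrans Y ** Y) $ i $ j = mat 1 $ i $ j" for i j
  proof -
    have "(ctrans Y ** Y) $ i $ j = (\<Sum>k\<in>UNIV. if k = i then (if i = j then cnj (d i) * d i else 0) else 0)"
      unfolding matrix_matrix_mult_def vec_lambda_beta by (intro sum.cong) (auto simp: Y_def)
    then show ?thesis by (simp add: mat_nth d_def)
  qed
  then have "ctrans Y ** Y = mat 1" by (simp add: vec_eq_iff)
  moreover have "det Y = (\<Prod>k\<in>UNIV. d k)"
    by (subst det_diagonal) (auto simp: Y_def)
  moreover have "(\<Prod>k\<in>UNIV. d k) = (\<Prod>k\<in>{a, b}. d k)"
    by (rule prod.mono_neutral_right) (auto simp: d_def)
  moreover have "(\<Prod>k\<in>{a, b}. d k) = 1" using ab by (simp add: d_def)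
  ultimately have "Y \<in> SU" by (simp add: SU_iff)
  moreover have "sharp par Y $ a $ a \<noteq> Y $ a $ a" by (simp add: sharp_nth Y_def d_def complex_eq_iff)
  then have "sharp par Y \<noteq> Y" by metis
  ultimately show thesis by (rule that)
qed

text \<open>The colouring \<open>par\<close> is the Red parity of walks from an arbitrary root
  \<open>r\<close>, well defined because no closed walk is odd. Red edges join different colours and
  all others equal ones, which is the condition for drift and controls to be fixed by
  \<open>sharp par\<close>.\<close>

lemma not_structurally_controllable:
  fixes As :: "('n::{finite,linorder}) cmat set"
  assumes card: "CARD('n) \<ge> 2" and As: "As \<subseteq> su"
    and S: "S1 \<subseteq> {(i, j). i < j}" "S2 \<subseteq> {(i, j). i < j}" "S3 \<subseteq> {(i, j). i < j}"
    and con: "connected_mg (G_contr S1 S2 S3)"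
    and nl: "\<not> has_self_loop (G_drift As \<union> G_contr S1 S2 S3)"
    and nc: "\<And>k. \<not> linked (G_drift As \<union> G_contr S1 S2 S3) k k True"
  shows "\<not> structurally_controllable As (ctrl S1 S2 S3)"
proof
  assume "structurally_controllable As (ctrl S1 S2 S3)"
  then obtain m B0 B where B0: "B0 \<in> Sigma_r As" and B: "\<And>i. i \<in> {1..m} \<Longrightarrow> B i \<in> Sigma_f (ctrl S1 S2 S3)"
    and ctl: "controllable B0 B m"
    unfolding structurally_controllable_def by blast
  define E where "E = G_drift As \<union> G_contr S1 S2 S3"
  define r :: 'n where "r = undefined"
  define par where "par v = linked E r v True" for v
  have par: "par v = p" if "linked E r v p" for v p
  proof -
    have "\<not> (linked E r v True \<and> linked E r v False)"
      using linked_trans [OF _ linked_sym, of E r v True r False] nc [of r] by (auto simp: E_def)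
    then show ?thesis using that by (cases p) (auto simp: par_def)
  qed
  have edge: "(par i = par j) = (c \<noteq> Red)" if e: "({i, j}, c) \<in> E" for i j c
  proof -
    obtain p where p: "linked (G_contr S1 S2 S3) r i p" using connected_mg_linked [OF con] by blast
    then have p: "linked E r i p" by (rule linked_mono) (simp add: E_def)
    have "linked E i j (c = Red)" using linked_edge [OF e] by simp
    from par [OF linked_trans [OF p this]] par [OF p] show ?thesis by auto
  qed
  have As_fixed: "As \<subseteq> {A. sharp par A = A}"
  proof clarify
    fix A
    assume A: "A \<in> As"
    then have su: "A \<in> su" using As by blast
    have "sharp par A $ i $ j = A $ i $ j" for i j
    proof (cases "i = j")
      case True
      have "A $ i $ i = 0"
      proof (rule ccontr)
        assume "A $ i $ i \<noteq> 0"
        then have "({i}, Green) \<in> G_drift As" using A unfolding G_drift_def by blast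
        then show False using nl by (auto simp: has_self_loop_def)
      qed
      then show ?thesis using True by (simp add: sharp_nth)
    next
      case False
      have 1: "({i, j}, Blue) \<in> E" if "Re (A $ i $ j) \<noteq> 0"
      proof -
        have "Re (A $ i $ j) = - Re (A $ j $ i)" using su_nth(1) [OF su, of i j] by simp
        then show ?thesis using that A False unfolding E_def G_drift_def by blast
      qed
      have 2: "({i, j}, Red) \<in> E" if "Im (A $ i $ j) \<noteq> 0"
      proof -
        have "Im (A $ i $ j) = Im (A $ j $ i)" using su_nth(1) [OF su, of i j] by simp
        then show ?thesis using that A False unfolding E_def G_drift_def by blast
      qed
      \<comment> \<open>A nonzero real part forces equal colours and a nonzero imaginary part
        different ones. At most one of them occurs, and the sign in \<open>sharp\<close> compensates
        the conjugation.\<close>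
      show ?thesis
        using edge [OF 1] edge [OF 2] by (auto simp: sharp_nth complex_eq_iff)
    qed
    then show "sharp par A = A" by (simp add: vec_eq_iff)
  qed
  have ctrl_fixed: "ctrl S1 S2 S3 \<subseteq> {A. sharp par A = A}"
  proof -
    have "S3 = {}"
      using nl by (auto simp: has_self_loop_def G_contr_def)
    moreover have "sharp par (Bmat i j) = Bmat i j" if "(i, j) \<in> S1" for i j
    proof -
      have "({i, j}, Blue) \<in> E" using that by (auto simp: E_def G_contr_def)
      then have "par i = par j" using edge by blast
      then show ?thesis by (rule sharp_Bmat)
    qed
    moreover have "sharp par (Cmat i j) = Cmat i j" if "(i, j) \<in> S2" for i j
    proof -
      have "({i, j}, Red) \<in> E" using that by (auto simp: E_def G_contr_def)
      then have "par i \<noteq> par j" using edge by blast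
      then show ?thesis by (rule sharp_Cmat)
    qed
    ultimately show ?thesis by (auto simp: ctrl_def)
  qed
  obtain Y :: "'n cmat" where Y: "Y \<in> SU" "sharp par Y \<noteq> Y"
    by (rule sharp_not_identity_on_SU [OF card])
  have "reachable B0 B m Y" using ctl Y(1) by (simp add: controllable_def)
  moreover have "B0 \<in> su" "B0 \<in> {A. sharp par A = A}"
    using B0 Sigma_r_subset_subspace [OF subspace_su As]
      Sigma_r_subset_subspace [OF subspace_sharp_fixed As_fixed] by blast+
  moreover have "B i \<in> su" "B i \<in> {A. sharp par A = A}" if "i \<in> {1..m}" for i
    using B [OF that] Sigma_f_subset_subspace [OF subspace_su ctrl_su [OF S(1,2)]]
      Sigma_f_subset_subspace [OF subspace_sharp_fixed ctrl_fixed]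
    by blast+
  ultimately show False
    using reachable_sharp_fixed [of B0 par m B Y] Y by blast
qed

theorem theorem4:
  fixes As :: "('n::{finite,linorder}) cmat set"
    and S1 S2 S3 :: "('n \<times> 'n) set"
  assumes "CARD('n) \<ge> 2"
    and "finite As" and "As \<subseteq> su"
    and "S1 \<subseteq> {(i, j). i < j}" and "S2 \<subseteq> {(i, j). i < j}" and "S3 \<subseteq> {(i, j). i < j}"
    and "connected_mg (G_contr S1 S2 S3)"
  shows "structurally_controllable As
           ((\<lambda>(i, j). Bmat i j) ` S1 \<union> (\<lambda>(i, j). Cmat i j) ` S2 \<union> (\<lambda>(i, j). Dmat i j) ` S3)
    \<longleftrightarrow> (has_self_loop (G_drift As \<union> G_contr S1 S2 S3) \<or>
         (\<exists>vs es. cycle (G_drift As \<union> G_contr S1 S2 S3) vs es \<and> odd (red_count es)))"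
  unfolding odd_cycle_iff_linked ctrl_def [symmetric]
proof
  assume "structurally_controllable As (ctrl S1 S2 S3)"
  then show "has_self_loop (G_drift As \<union> G_contr S1 S2 S3) \<or> (\<exists>i. linked (G_drift As \<union> G_contr S1 S2 S3) i i True)"
    using not_structurally_controllable [OF assms(1,3-7)] by blast
next
  assume "has_self_loop (G_drift As \<union> G_contr S1 S2 S3) \<or> (\<exists>i. linked (G_drift As \<union> G_contr S1 S2 S3) i i True)"
  then obtain k where cond: "has_self_loop (G_drift As \<union> G_contr S1 S2 S3) \<or> linked (G_drift As \<union> G_contr S1 S2 S3) k k True"
    by blast
  obtain B0 where B0: "B0 \<in> Sigma_r As"
    and gen: "\<And>L. lie_subalgebra L \<Longrightarrow> ctrl S1 S2 S3 \<subseteq> L \<Longrightarrow> B0 \<in> L \<Longrightarrow> su \<subseteq> L"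
  proof (rule drift_choice [OF assms(2-7) cond])
    fix B0
    assume 1: "B0 \<in> Sigma_r As"
      and 2: "\<And>L. lie_subalgebra L \<Longrightarrow> ctrl S1 S2 S3 \<subseteq> L \<Longrightarrow> B0 \<in> L \<Longrightarrow> su \<subseteq> L"
    show thesis by (rule that [OF 1 2])
  qed
  have B0_su: "B0 \<in> su" using B0 Sigma_r_subset_subspace [OF subspace_su assms(3)] by blast
  have c_su: "ctrl S1 S2 S3 \<subseteq> su" by (rule ctrl_su [OF assms(4,5)])
  have fin: "finite (ctrl S1 S2 S3)" unfolding ctrl_def by simp
  \<comment> \<open>One control per element of the control set, plus a last one equal to 0, which
    makes \<open>m \<ge> 1\<close> immediate.\<close>
  define m where "m = Suc (card (ctrl S1 S2 S3))"
  obtain h where h: "bij_betw h {1..card (ctrl S1 S2 S3)} (ctrl S1 S2 S3)"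
    using ex_bij_betw_nat_finite_1 [OF fin] by blast
  define B where "B i = (if i = m then 0 else h i)" for i
  have B_range: "B ` {1..m} = insert 0 (ctrl S1 S2 S3)"
  proof -
    have "{1..m} = insert m {1..card (ctrl S1 S2 S3)}" by (auto simp: m_def)
    moreover have "B ` {1..card (ctrl S1 S2 S3)} = h ` {1..card (ctrl S1 S2 S3)}"
      by (intro image_cong) (auto simp: B_def m_def)
    moreover have "B m = 0" by (simp add: B_def)
    ultimately show ?thesis using bij_betw_imp_surj_on [OF h] by (simp only: image_insert)
  qed
  have in_f: "g \<in> Sigma_f (ctrl S1 S2 S3)" if "g \<in> insert 0 (ctrl S1 S2 S3)" for g
  proof -
    have "g = (\<Sum>x\<in>ctrl S1 S2 S3. (if x = g then 1 else 0) *\<^sub>R x)"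
    proof -
      have "(\<Sum>x\<in>ctrl S1 S2 S3. (if x = g then 1 else 0) *\<^sub>R x) = (\<Sum>x\<in>ctrl S1 S2 S3. if x = g then g else 0)"
        by (intro sum.cong) auto
      then show ?thesis using fin that by auto
    qed
    then show ?thesis
      unfolding Sigma_f_def mem_Collect_eq
      by (intro exI [of _ "\<lambda>x. if x = g then 1 else 0"] conjI TrueI)
  qed
  define WW where "WW = {B0 + (\<Sum>i\<in>{1..m}. c i *\<^sub>R B i) | c. True}"
  have in_WW: "B0 + (\<Sum>i\<in>{1..m}. c i *\<^sub>R B i) \<in> WW" for c
    unfolding WW_def by blast
  have B_in: "B i \<in> insert 0 (ctrl S1 S2 S3)" if "i \<in> {1..m}" for i
    using B_range that by blast
  have "B i \<in> su" if "i \<in> {1..m}" for i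
    using B_in [OF that] c_su subspace_0 [OF subspace_su] by auto
  then have WW_su: "WW \<subseteq> su"
    unfolding WW_def using B0_su
    by (auto intro!: subspace_add [OF subspace_su] subspace_sum [OF subspace_su] subspace_scale [OF subspace_su])
  have "exp_semigroup WW = SU"
  proof (rule exp_semigroup_eq_SU [OF WW_su])
    fix L
    assume L: "lie_subalgebra L" and W: "WW \<subseteq> L"
    \<comment> \<open>The zero control puts \<open>B0\<close> into \<open>L\<close>; a single unit
      control gives \<open>B0 + B k\<close>, and subtraction recovers each control matrix.\<close>
    have "B0 + (\<Sum>i\<in>{1..m}. 0 *\<^sub>R B i) \<in> WW" by (rule in_WW)
    then have B0_L: "B0 \<in> L" using W by auto
    have "ctrl S1 S2 S3 \<subseteq> L"
    proof
      fix g
      assume "g \<in> ctrl S1 S2 S3"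
      then have "g \<in> B ` {1..m}" unfolding B_range by simp
      then obtain k where k: "k \<in> {1..m}" "g = B k" by blast
      have "B0 + (\<Sum>i\<in>{1..m}. (if i = k then 1 else 0) *\<^sub>R B i) \<in> WW" by (rule in_WW)
      moreover have "(\<Sum>i\<in>{1..m}. (if i = k then 1 else 0) *\<^sub>R B i) = (\<Sum>i\<in>{1..m}. if i = k then B k else 0)"
        by (intro sum.cong) auto
      ultimately have "B0 + g \<in> L" using W k by auto
      then have "B0 + g - B0 \<in> L" using B0_L by (rule lie_subalgebraD [OF L])
      then show "g \<in> L" by simp
    qed
    then show "su \<subseteq> L" using gen L B0_L by blast
  qed
  then have "controllable B0 B m"
    unfolding controllable_def using exp_semigroup_reachable unfolding WW_def by blast
  moreover have "m \<ge> 1" by (simp add: m_def)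
  ultimately show "structurally_controllable As (ctrl S1 S2 S3)"
    unfolding structurally_controllable_def using B0 B_in in_f by blast
qed

end
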